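(* Let $0<\gamma<\gamma'<1$ and $\delta>0$ with $\delta<\gamma$. If $T$ is weakly mixing and $(T,S)\in\mathcal{L}^{\gamma,\gamma',\delta}$, then the Cartesian product $T\times S$ is not loosely Bernoulli.
   Context: **Rank one systems.** Fix a sequence of cuts $(p_n)_{n\in\mathbb{N}}$ of integers with $p_n>1$ for all $n$ and spacers $(a_{n,i})_{i=1}^{p_n}$, $n\in\mathbb{N}=\{1,2,\dots\}$ (nonnegative integers). Heights: $h_1=1$ and $h_n=p_{n-1}h_{n-1}+\sum_{i=1}^{p_{n-1}}a_{n-1,i}$. The rank one transformation $T$ is built by cutting and stacking: $\mathcal{T}_1=[0,1]$ is a tower with one level. At stage $n$, the tower $\mathcal{T}_n$ ($h_n$ levels, which are intervals of equal width; $T$ maps each level but the last to the level just above it by translation) is cut into $p_n$ subtowers of equal width; over the $i$-th subtower one puts $a_{n,i}$ spacers (new disjoint intervals of the same width as the levels of the subtower), and then the subtowers with their spacers are stacked, each on top of the previous one, to obtain $\mathcal{T}_{n+1}$, which has $h_{n+1}$ levels. $T$ is then defined almost everywhere on $\mathcal{T}_\infty=\bigcup_n\mathcal{T}_n$. It is assumed that $\sum_{n\ge1}\frac{1}{\prod_{k=1}^n p_k}\bigl(\sum_{i=1}^{p_n}a_{n,i}\bigr)<+\infty$, so that $T$ preserves the probability measure $\mu_T$ given by normalized Lebesgue measure on $\mathcal{T}_\infty$. The set of such transformations is denoted $Rank(1)$. A superscript $T$ ($p_n^T,a_{n,i}^T,h_n^T,\mathcal{T}_n^T$) indicates the transformation.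 **The class $\mathcal{C}_{\gamma,\gamma'}$.** For $0<\gamma<\gamma'<1$, $\mathcal{C}_{\gamma,\gamma'}$ is the set of $T\in Rank(1)$ for which there is $n'_T\in\mathbb{N}$ such that for every $n\ge n'_T$: $p_n^T\in[(h_n^T)^\gamma,(h_n^T)^{\gamma'})$, $a_{n,i}^T>a_{n,i-1}^T$ for $i=2,\dots,p_n^T$, and $a^T_{n,p_n^T}\le (h_n^T)^{\gamma'}$. **Alternating sequences.** For $\delta>0$ and increasing sequences of positive integers $(a_n),(b_n)$, $(b_n)$ is $(a_n)$-alternating with exponent $\delta$ if there is $n_0$ such that for every $n\ge n_0$, if $m(n)$ is the unique index with $b_{m(n)}\le a_n<b_{m(n)+1}$, then $b_{m(n)}^{1+\delta}<a_n$ and $a_n^{1+\delta}<b_{m(n)+1}$. The sequences are $\delta$-alternating if $(a_n)$ is $(b_n)$-alternating with exponent $\delta$ and $(b_n)$ is $(a_n)$-alternating with exponent $\delta$. **The class $\mathcal{L}^{\gamma,\gamma',\delta}$.** $\mathcal{L}^{\gamma,\gamma',\delta}$ is the set of pairs $(T,S)\in\mathcal{C}_{\gamma,\gamma'}\times\mathcal{C}_{\gamma,\gamma'}$ such that $(h_n^T)$ and $(h_n^S)$ are $\delta$-alternating. **Loosely Bernoulli.** For words $A=a_1\dots a_k$, $B=b_1\dots b_k$ over a finite alphabet, a matching is a pair of strictly increasing sequences $(i_s,j_s)_{s=1}^r$ of indices with $a_{i_s}=b_{j_s}$ for all $s$; $\bar f(A,B)=1-\frac rk$ with $r$ the maximal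 cardinality of a matching. For a measure preserving automorphism $R$ of a probability space $(X,\mathcal{B},\mu)$, a finite measurable partition $\mathcal{P}=(P_1,\dots,P_q)$ and $N\ge1$, $\mathcal{P}_0^N(x)=x_0\dots x_{N-1}$ where $R^i x\in P_{x_i}$. The process $(R,\mathcal{P})$ is loosely Bernoulli if for every $\varepsilon>0$ there are $N_\varepsilon\in\mathbb{N}$ and $A_\varepsilon\in\mathcal{B}$ with $\mu(A_\varepsilon)>1-\varepsilon$ such that $\bar f(\mathcal{P}_0^N(x),\mathcal{P}_0^N(y))<\varepsilon$ for all $x,y\in A_\varepsilon$ and $N\ge N_\varepsilon$. $R$ is loosely Bernoulli if $(R,\mathcal{P})$ is loosely Bernoulli for every finite measurable partition $\mathcal{P}$. The product $T\times S$ is considered with the measure $\mu_T\times\mu_S$. *)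

theory Defs
  imports "HOL-Probability.Probability"
begin

section \<open>Rank one transformations\<close>

text \<open>
  A rank one transformation is kept together with the cutting and stacking that produces it.
  Stages are numbered from 1 (values at stage 0 are never used), subtowers of stage \<open>n\<close> are
  numbered \<open>1, ..., cuts R n\<close>, and the levels of the tower \<open>n\<close> are numbered from the bottom by
  \<open>0, ..., height R n - 1\<close>. The number \<open>left_end R n j\<close> is the left endpoint of the \<open>j\<close>-th level;
  the placement of the spacers on the real line is left free, as in the cutting and stacking
  construction.
\<close>

record rank_one_system =
  cuts :: "nat \<Rightarrow> nat"
  spacers :: "nat \<Rightarrow> nat \<Rightarrow> nat"
  left_end :: "nat \<Rightarrow> nat \<Rightarrow> real"
  transf :: "real \<Rightarrow> real"

fun height :: "rank_one_system \<Rightarrow> nat \<Rightarrow> nat" where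
  "height R 0 = 0"
| "height R (Suc 0) = 1"
| "height R (Suc (Suc n)) =
     cuts R (Suc n) * height R (Suc n) + (\<Sum>i=1..cuts R (Suc n). spacers R (Suc n) i)"

definition width :: "rank_one_system \<Rightarrow> nat \<Rightarrow> real" where
  "width R n = 1 / (\<Prod>k=1..<n. real (cuts R k))"

text \<open>
  Levels are half-open intervals, so that cutting a level yields an exact partition; compared with
  closed intervals this changes only null sets. With this convention every point of
  \<open>total_space R\<close> lies below the top level of some tower, so the conditions in \<open>rank_one\<close>
  determine \<open>transf R\<close> on all of \<open>total_space R\<close>.
\<close>

definition level :: "rank_one_system \<Rightarrow> nat \<Rightarrow> nat \<Rightarrow> real set" where
  "level R n j = {left_end R n j ..< left_end R n j + width R n}"

definition tower :: "rank_one_system \<Rightarrow> nat \<Rightarrow> real set" where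
  "tower R n = (\<Union>j<height R n. level R n j)"

definition total_space :: "rank_one_system \<Rightarrow> real set" where
  "total_space R = (\<Union>n\<in>{1..}. tower R n)"

text \<open>The index, in tower \<open>n + 1\<close>, of the lowest level of the \<open>i\<close>-th subtower of tower \<open>n\<close>.\<close>

definition subtower_base :: "rank_one_system \<Rightarrow> nat \<Rightarrow> nat \<Rightarrow> nat" where
  "subtower_base R n i = (\<Sum>k=1..<i. height R n + spacers R n k)"

text \<open>
  The remaining levels of tower \<open>n + 1\<close>, i.e. those with index
  \<open>subtower_base R n i + height R n + r\<close> where \<open>r < spacers R n i\<close>, are the spacers. Disjointness
  of the levels of tower \<open>n + 1\<close> says that they are new, i.e. disjoint from tower \<open>n\<close> and from each
  other, since tower \<open>n\<close> is the union of the levels of its subtowers.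
\<close>

definition rank_one :: "rank_one_system set" where
  "rank_one = {R.
     (\<forall>n\<ge>1. 1 < cuts R n) \<and>
     left_end R 1 0 = 0 \<and>
     (\<forall>n\<ge>1. disjoint_family_on (level R n) {..<height R n}) \<and>
     (\<forall>n\<ge>1. \<forall>i\<in>{1..cuts R n}. \<forall>j<height R n.
        left_end R (n + 1) (subtower_base R n i + j)
          = left_end R n j + (real i - 1) * width R (n + 1)) \<and>
     (\<forall>n\<ge>1. \<forall>j. j + 1 < height R n \<longrightarrow>
        (\<forall>x\<in>level R n j. transf R x = x + (left_end R n (j + 1) - left_end R n j))) \<and>
     summable (\<lambda>m. let n = m + 1 in
        1 / (\<Prod>k=1..n. real (cuts R k)) * (\<Sum>i=1..cuts R n. real (spacers R n i)))}"

definition rank_one_measure :: "rank_one_system \<Rightarrow> real measure" where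
  "rank_one_measure R = uniform_measure (restrict_space lborel (total_space R)) (total_space R)"


section \<open>The classes of transformations and of pairs\<close>

definition class_C :: "real \<Rightarrow> real \<Rightarrow> rank_one_system set" where
  "class_C \<gamma> \<gamma>' = {R \<in> rank_one. \<exists>n'\<ge>1. \<forall>n\<ge>n'.
     real (cuts R n) \<in> {real (height R n) powr \<gamma> ..< real (height R n) powr \<gamma>'} \<and>
     (\<forall>i\<in>{2..cuts R n}. spacers R n (i - 1) < spacers R n i) \<and>
     real (spacers R n (cuts R n)) \<le> real (height R n) powr \<gamma>'}"

text \<open>
  \<open>alternating_wrt a b \<delta>\<close>: the sequence \<open>b\<close> is \<open>a\<close>-alternating with exponent \<open>\<delta>\<close>. It is meant for
  strictly increasing sequences of positive integers indexed from 1 (as the heights are), for which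
  the index \<open>m\<close> exists and is unique as soon as \<open>n\<close> is large.
\<close>

definition alternating_wrt :: "(nat \<Rightarrow> nat) \<Rightarrow> (nat \<Rightarrow> nat) \<Rightarrow> real \<Rightarrow> bool" where
  "alternating_wrt a b \<delta> \<longleftrightarrow> (\<exists>n0\<ge>1. \<forall>n\<ge>n0. \<forall>m\<ge>1. b m \<le> a n \<and> a n < b (m + 1) \<longrightarrow>
     real (b m) powr (1 + \<delta>) < real (a n) \<and> real (a n) powr (1 + \<delta>) < real (b (m + 1)))"

definition alternating :: "real \<Rightarrow> (nat \<Rightarrow> nat) \<Rightarrow> (nat \<Rightarrow> nat) \<Rightarrow> bool" where
  "alternating \<delta> a b \<longleftrightarrow> alternating_wrt a b \<delta> \<and> alternating_wrt b a \<delta>"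

definition class_L :: "real \<Rightarrow> real \<Rightarrow> real \<Rightarrow> (rank_one_system \<times> rank_one_system) set" where
  "class_L \<gamma> \<gamma>' \<delta> =
     {(T, S) \<in> class_C \<gamma> \<gamma>' \<times> class_C \<gamma> \<gamma>'. alternating \<delta> (height T) (height S)}"


section \<open>Weak mixing\<close>

definition weakly_mixing :: "'a measure \<Rightarrow> ('a \<Rightarrow> 'a) \<Rightarrow> bool" where
  "weakly_mixing M R \<longleftrightarrow> (\<forall>A\<in>sets M. \<forall>B\<in>sets M.
     (\<lambda>N. (\<Sum>n<N. \<bar>measure M ((R ^^ n) -` A \<inter> B) - measure M A * measure M B\<bar>) / real N)
       \<longlonglongrightarrow> 0)"


section \<open>Loosely Bernoulli transformations\<close>

definition matching ::
  "'b list \<Rightarrow> 'b list \<Rightarrow> nat \<Rightarrow> (nat \<Rightarrow> nat) \<Rightarrow> (nat \<Rightarrow> nat) \<Rightarrow> bool" where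
  "matching A B r i j \<longleftrightarrow>
     strict_mono_on {..<r} i \<and> strict_mono_on {..<r} j \<and>
     (\<forall>s<r. i s < length A \<and> j s < length B \<and> A ! i s = B ! j s)"

text \<open>Only used for words \<open>A\<close>, \<open>B\<close> of the same positive length.\<close>

definition fbar :: "'b list \<Rightarrow> 'b list \<Rightarrow> real" where
  "fbar A B = 1 - real (Max {r. \<exists>i j. matching A B r i j}) / real (length A)"

definition finite_measurable_partition :: "'a measure \<Rightarrow> nat \<Rightarrow> (nat \<Rightarrow> 'a set) \<Rightarrow> bool" where
  "finite_measurable_partition M q P \<longleftrightarrow>
     (\<forall>k\<in>{1..q}. P k \<in> sets M) \<and> disjoint_family_on P {1..q} \<and> (\<Union>k\<in>{1..q}. P k) = space M"

definition name_word :: "('a \<Rightarrow> 'a) \<Rightarrow> nat \<Rightarrow> (nat \<Rightarrow> 'a set) \<Rightarrow> nat \<Rightarrow> 'a \<Rightarrow> nat list" where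
  "name_word R q P N x = map (\<lambda>i. THE k. k \<in> {1..q} \<and> (R ^^ i) x \<in> P k) [0..<N]"

definition loosely_bernoulli_process ::
  "'a measure \<Rightarrow> ('a \<Rightarrow> 'a) \<Rightarrow> nat \<Rightarrow> (nat \<Rightarrow> 'a set) \<Rightarrow> bool" where
  "loosely_bernoulli_process M R q P \<longleftrightarrow>
     (\<forall>\<epsilon>>0. \<exists>N\<epsilon>\<ge>1. \<exists>A\<in>sets M. measure M A > 1 - \<epsilon> \<and>
        (\<forall>x\<in>A. \<forall>y\<in>A. \<forall>N\<ge>N\<epsilon>. fbar (name_word R q P N x) (name_word R q P N y) < \<epsilon>))"

definition loosely_bernoulli :: "'a measure \<Rightarrow> ('a \<Rightarrow> 'a) \<Rightarrow> bool" where
  "loosely_bernoulli M R \<longleftrightarrow>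
     (\<forall>q P. finite_measurable_partition M q P \<longrightarrow> loosely_bernoulli_process M R q P)"

end

theory Submission
  imports Defs
begin

text \<open>
The reason is a conflict between the two systems. Take two points \<open>(x, y)\<close> and \<open>(x', y')\<close> and a matching
of long names with respect to a partition into products of levels of two fixed towers. A matched pair of
times \<open>(s, t)\<close> is called synchronised at a stage of \<open>T\<close> or \<open>S\<close> if the two orbits are on the same level of
the tower of this stage at these times. Nearly all equal letters give pairs synchronised at the starting
stages.

Suppose pairs are synchronised at stage \<open>n\<close> of \<open>T\<close> and stage \<open>m\<close> of \<open>S\<close>, where tower \<open>n\<close> of \<open>T\<close> has height
\<open>h\<close> and tower \<open>m\<close> of \<open>S\<close> is much higher. During a common passage through tower \<open>m\<close> of \<open>S\<close> the time shift
\<open>t - s\<close> is constant. In this time \<open>x\<close> and \<open>x'\<close> pass through many copies of tower \<open>n\<close> of \<open>T\<close>. If the copies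
that are matched have different indices in tower \<open>n + 1\<close>, then the spacers following them are different,
because the spacers of a stage are strictly increasing; after one such copy the alignment is lost, and
it does not come back for a long time. Hence the number of pairs that are not also synchronised at stage
\<open>n + 1\<close> is at most of order \<open>N * h powr (- \<beta>)\<close>, where \<open>N\<close> is the length of the names and \<open>\<beta> > 0\<close> depends
only on the exponents of the classes (\<open>promotion\<close>, \<open>promotion_cost\<close>). If instead the tower of \<open>T\<close> is the
higher one, the same applies to \<open>S\<close>. Alternation guarantees that one of the two is always much higher, so
by always promoting the lower tower one climbs to arbitrarily high stages, and as the heights at least
double from stage to stage the total loss is small (\<open>few_synced_pairs\<close>).

Now let the length of the names be about an eighth of the height of a tower \<open>K\<close> of \<open>T\<close>, and choose \<open>x\<close> in
the lowest quarter of this tower and \<open>x'\<close> in the third quarter. Then no pair of times at all is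
synchronised at stage \<open>K\<close>, so the number of synchronised pairs at the starting stages was small from the
beginning, and the matching covers at most half of the names (\<open>matching_bound\<close>). The points
allowed here form sets of measure bounded below, so they meet every set of measure close to 1, which
contradicts the definition of a loosely Bernoulli process.
\<close>

section \<open>Heights and subtowers\<close>

lemma height_Suc:
  "n \<ge> 1 \<Longrightarrow> height R (Suc n) = cuts R n * height R n + (\<Sum>i=1..cuts R n. spacers R n i)"
  by (cases n) auto

lemma subtower_base_diff:
  assumes "1 \<le> i" "i \<le> i'"
  shows "subtower_base R n i' = subtower_base R n i + (\<Sum>k=i..<i'. height R n + spacers R n k)"
  unfolding subtower_base_def using assms by (simp add: sum.atLeastLessThan_concat)

lemma subtower_base_less:
  assumes "1 \<le> i" "i < i'"
  shows "subtower_base R n i + height R n \<le> subtower_base R n i'"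
proof -
  have "height R n + spacers R n i \<le> (\<Sum>k=i..<i'. height R n + spacers R n k)"
    using assms by (intro member_le_sum[of i "{i..<i'}" "\<lambda>k. height R n + spacers R n k"]) auto
  then show ?thesis using subtower_base_diff[of i i' R n] assms by simp
qed

lemma subtower_base_top:
  assumes "n \<ge> 1"
  shows "subtower_base R n (Suc (cuts R n)) = height R (Suc n)"
  unfolding subtower_base_def height_Suc[OF assms]
  by (simp add: sum.distrib atLeastLessThanSuc_atLeastAtMost)

lemma subtower_in_tower:
  assumes "n \<ge> 1" "i \<in> {1..cuts R n}"
  shows "subtower_base R n i + height R n \<le> height R (Suc n)"
  using subtower_base_less[of i "Suc (cuts R n)" R n] assms subtower_base_top[of n R] by simp

lemma height_pos: 
  assumes "\<forall>n\<ge>1. 1 < cuts R n" "n \<ge> 1"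
  shows "height R n > 0"
  using assms(2)
proof (induction n rule: dec_induct)
  case (step n)
  have "cuts R n * height R n > 0" using assms(1) step by force
  then show ?case using height_Suc[of n R] step by simp
qed simp

lemma height_double:
  assumes "\<forall>n\<ge>1. 1 < cuts R n" "n \<ge> 1"
  shows "2 * height R n \<le> height R (Suc n)"
proof -
  have "2 * height R n \<le> cuts R n * height R n" using assms by (intro mult_right_mono) (auto simp: numeral_2_eq_2 Suc_le_eq)
  then show ?thesis using height_Suc[OF assms(2), of R] by linarith
qed

lemma height_strict_mono:
  assumes "\<forall>n\<ge>1. 1 < cuts R n" "1 \<le> n" "n < n'"
  shows "height R n < height R n'"
  using less_Suc_induct[of n n' "\<lambda>a b. 1 \<le> a \<longrightarrow> height R a < height R b"]
  using assms height_double[OF assms(1)] height_pos[OF assms(1)] by fastforce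

lemma height_mono:
  assumes "\<forall>n\<ge>1. 1 < cuts R n" "1 \<le> n" "n \<le> n'"
  shows "height R n \<le> height R n'"
  using height_strict_mono[OF assms(1,2)] assms(3) by (cases "n = n'") (auto simp: less_imp_le)

lemma height_ge:
  assumes "\<forall>n\<ge>1. 1 < cuts R n" "n \<ge> 1"
  shows "n \<le> height R n"
  using assms(2)
proof (induction n rule: dec_induct)
  case (step n)
  then show ?case using height_double[OF assms(1) step(1)] height_pos[OF assms(1) step(1)] by linarith
qed simp

section \<open>Copies of a tower inside a higher tower\<close>

text \<open>
Read from bottom to top, tower \<open>K\<close> is a word made of copies of tower \<open>n\<close> and spacers, for every
\<open>n \<le> K\<close>. \<open>block_start R K n b\<close> means that one of these copies of tower \<open>n\<close> starts at position
\<open>b\<close>. All statements about orbits below are statements about positions in such a word.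
\<close>

inductive block_start :: "rank_one_system \<Rightarrow> nat \<Rightarrow> nat \<Rightarrow> nat \<Rightarrow> bool" for R K where
  whole: "block_start R K K 0"
| subtower: "block_start R K (Suc n) b \<Longrightarrow> 1 \<le> n \<Longrightarrow> i \<in> {1..cuts R n} \<Longrightarrow>
    block_start R K n (b + subtower_base R n i)"

lemma block_start_le: "block_start R K n b \<Longrightarrow> n \<le> K"
  by (induction rule: block_start.induct) auto

lemma block_start_top: "block_start R K K b \<longleftrightarrow> b = 0"
  using block_start_le[of R K "Suc K"] by (auto elim: block_start.cases intro: block_start.intros)

lemma block_start_parent:
  assumes "block_start R K n b" "n < K"
  obtains b' i where "block_start R K (Suc n) b'" "i \<in> {1..cuts R n}" "b = b' + subtower_base R n i"
  using assms by (cases rule: block_start.cases) auto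

lemma block_start_fits:
  "block_start R K n b \<Longrightarrow> b + height R n \<le> height R K"
proof (induction rule: block_start.induct)
  case (subtower n b i)
  then show ?case using subtower_in_tower[of n i R] by simp
qed simp

text \<open>
Two copies either lie in the same copy of the next tower, where the bases of the subtowers are at
least one height apart, or in different ones, which are disjoint by induction. The induction descends
from stage \<open>K\<close>, and only the symmetric form of the claim is inductive.
\<close>

lemma block_start_separated:
  assumes "block_start R K n b" "block_start R K n b'" "b < b'"
  shows "b + height R n \<le> b'"
proof -
  have "b = b' \<or> b + height R n \<le> b' \<or> b' + height R n \<le> b"
    using assms(1,2)
  proof (induction arbitrary: b' rule: block_start.induct)
    case whole
    then show ?case by (simp add: block_start_top)
  next
    case (subtower n b i)
    have "Suc n \<le> K" using subtower block_start_le by blast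
    then obtain c k where c: "block_start R K (Suc n) c" "k \<in> {1..cuts R n}"
        "b' = c + subtower_base R n k"
      using block_start_parent[OF subtower.prems(1)] by (metis Suc_le_eq)
    have fit: "subtower_base R n i + height R n \<le> height R (Suc n)"
      "subtower_base R n k + height R n \<le> height R (Suc n)"
      using subtower_in_tower subtower c by auto
    have "i = k \<or> subtower_base R n i + height R n \<le> subtower_base R n k
        \<or> subtower_base R n k + height R n \<le> subtower_base R n i"
      using subtower_base_less[of i k R n] subtower_base_less[of k i R n] subtower c
      by (metis atLeastAtMost_iff nat_neq_iff)
    then show ?case using subtower.IH[OF c(1)] fit c by auto
  qed
  then show ?thesis using assms(3) by auto
qed

text \<open>
The two positions lie on the same level of tower \<open>n\<close>. Expressing this through copies of tower \<open>n\<close> keeps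
the counting below free of the geometry of the levels.
\<close>

definition synced :: "rank_one_system \<Rightarrow> nat \<Rightarrow> nat \<Rightarrow> nat \<Rightarrow> nat \<Rightarrow> bool" where
  "synced R K n l l' \<longleftrightarrow> (\<exists>b b'. \<exists>j<height R n.
     block_start R K n b \<and> block_start R K n b' \<and> l = b + j \<and> l' = b' + j)"

section \<open>Counting pairs that agree at one stage but not at the next\<close>

text \<open>
The form of the pigeonhole principle in which unsynchronised pairs are counted: a label with few
values and small fibres.
\<close>

lemma card_le_fibres:
  fixes F :: "'a \<Rightarrow> nat"
  assumes "finite M" "F ` M \<subseteq> {lo..lo + r}" "\<And>p. p \<in> M \<Longrightarrow> card {q \<in> M. F q = F p} \<le> h"
  shows "card M \<le> h * (r + 1)"
proof -
  have "M = (\<Union>v\<in>F ` M. {q \<in> M. F q = v})" by auto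
  then have "card M \<le> (\<Sum>v\<in>F ` M. card {q \<in> M. F q = v})"
    using card_UN_le[of "F ` M" "\<lambda>v. {q \<in> M. F q = v}"] assms(1) by simp
  also have "\<dots> \<le> card (F ` M) * h"
    using sum_bounded_above[of "F ` M" "\<lambda>v. card {q \<in> M. F q = v}" h] assms(3) by auto
  also have "\<dots> \<le> (r + 1) * h"
    using card_mono[OF _ assms(2)] by (intro mult_right_mono) auto
  finally show ?thesis by (simp add: mult.commute)
qed

text \<open>
Starting points of non-overlapping blocks of length \<open>H\<close>.
\<close>

definition separated :: "nat \<Rightarrow> nat set \<Rightarrow> bool" where
  "separated H Q \<longleftrightarrow> (\<forall>c\<in>Q. \<forall>c'\<in>Q. c < c' \<longrightarrow> c + H \<le> c')"

lemma separated_mono: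
  assumes "separated H Q" "c \<in> Q" "c' \<in> Q" "c \<le> l" "l < c + H" "c' \<le> l'" "l' < c' + H" "l \<le> l'"
  shows "c \<le> c'"
  using assms unfolding separated_def by (meson le_trans linorder_not_less)

text \<open>
The quotient by \<open>H\<close> numbers the blocks: it is monotone in the starting point and, since no window
of length \<open>H\<close> contains two starting points, it is injective.
\<close>

lemma separated_div_eq:
  assumes "separated H Q" "c \<in> Q" "c' \<in> Q" "H > 0" "c div H = c' div H"
  shows "c = c'"
proof -
  have "\<not> c < c'" if "separated H Q" "c \<in> Q" "c' \<in> Q" "c div H = c' div H" for c c'
  proof
    assume "c < c'"
    then have "c + H \<le> c'" using that unfolding separated_def by blast
    then have "(c + H) div H \<le> c' div H" by (rule div_le_mono)
    then show False using that \<open>H > 0\<close> by simp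
  qed
  from this[of c c'] this[of c' c] show ?thesis using assms by auto
qed

text \<open>
The block containing position \<open>l + s\<close> may begin before \<open>l\<close>; the shift by 1 makes room for that.
\<close>

lemma block_index_range:
  fixes c :: nat
  assumes "H > 0" "c \<le> l + s" "l + s < c + H" "s < N"
  shows "c div H + 1 \<in> {l div H..l div H + (N div H + 2)}"
proof -
  have "l div H \<le> (c + H) div H" using assms by (intro div_le_mono) simp
  moreover have "c div H \<le> (l + N) div H" using assms by (intro div_le_mono) simp
  moreover have "(l + N) div H \<le> l div H + N div H + 1"
  proof -
    have "(l + N) div H = l div H + N div H + (l mod H + N mod H) div H" by (rule div_add1_eq)
    moreover have "l mod H + N mod H < H + H" using assms(1) by (intro add_strict_mono) auto
    then have "(l mod H + N mod H) div H < 2" using less_mult_imp_div_less[of _ 2 H] by simp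
    ultimately show ?thesis by linarith
  qed
  ultimately show ?thesis using assms(1) by simp
qed

text \<open>
This is where the strict increase of the spacers enters. Suppose the copies \<open>i\<^sub>1\<close> and \<open>i\<^sub>2\<close> of a tower
of height \<open>h\<close> are exactly as far apart as the copies \<open>k\<^sub>1\<close> and \<open>k\<^sub>2\<close>, where \<open>k\<^sub>1 > i\<^sub>1\<close>. Because the
spacers grow, the stretch starting at \<open>k\<^sub>1\<close> would be longer if it contained at least as many copies.
So it contains fewer, and the missing height \<open>h\<close> has to be made up by spacers, each of size at most
\<open>a p\<close>. A short stretch does not have enough of them.
\<close>

lemma shifted_index_unique:
  fixes a :: "nat \<Rightarrow> nat" and h :: nat
  assumes incr: "strict_mono_on {1..p} a"
    and ends: "1 \<le> i\<^sub>1" "i\<^sub>1 < i\<^sub>2" "i\<^sub>2 \<le> p" "1 \<le> k\<^sub>1" "i\<^sub>1 < k\<^sub>1" "k\<^sub>2 \<le> p"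
    and eq: "(\<Sum>q=i\<^sub>1..<i\<^sub>2. h + a q) = (\<Sum>q=k\<^sub>1..<k\<^sub>2. h + a q)"
    and short: "(i\<^sub>2 - i\<^sub>1) * a p < h \<or> (k\<^sub>2 - k\<^sub>1) * a p < h"
  shows False
proof -
  define d where "d = i\<^sub>2 - i\<^sub>1"
  have d: "i\<^sub>2 = i\<^sub>1 + d" "d > 0" using ends d_def by auto
  have "k\<^sub>2 < k\<^sub>1 + d"
  proof (rule ccontr)
    assume long: "\<not> ?thesis"
    then have "(\<Sum>q=k\<^sub>1..<k\<^sub>1+d. h + a q) \<le> (\<Sum>q=k\<^sub>1..<k\<^sub>2. h + a q)"
      by (intro sum_mono2) auto
    moreover have "(\<Sum>q=k\<^sub>1..<k\<^sub>1+d. h + a q) = (\<Sum>q=i\<^sub>1..<i\<^sub>1+d. h + a (q + (k\<^sub>1 - i\<^sub>1)))"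
      using sum.shift_bounds_nat_ivl[of "\<lambda>q. h + a q" i\<^sub>1 "k\<^sub>1 - i\<^sub>1" "i\<^sub>1 + d"] ends
      by (simp add: algebra_simps)
    moreover have "(\<Sum>q=i\<^sub>1..<i\<^sub>1+d. h + a q) < (\<Sum>q=i\<^sub>1..<i\<^sub>1+d. h + a (q + (k\<^sub>1 - i\<^sub>1)))"
    proof (rule sum_strict_mono)
      fix q assume "q \<in> {i\<^sub>1..<i\<^sub>1+d}"
      then show "h + a q < h + a (q + (k\<^sub>1 - i\<^sub>1))"
        using incr ends d long by (auto intro!: strict_mono_onD[OF incr])
    qed (use d in auto)
    ultimately show False using eq d by simp
  qed
  define e where "e = k\<^sub>2 - k\<^sub>1"
  have e: "e < d" using \<open>k\<^sub>2 < k\<^sub>1 + d\<close> d e_def by linarith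
  have "(e + 1) * h \<le> d * h" using e by (intro mult_right_mono) auto
  also have "d * h \<le> (\<Sum>q=i\<^sub>1..<i\<^sub>2. h + a q)" using d by (simp add: sum.distrib)
  also have "\<dots> = (\<Sum>q=k\<^sub>1..<k\<^sub>2. h + a q)" by (rule eq)
  also have "\<dots> \<le> (\<Sum>q=k\<^sub>1..<k\<^sub>2. h + a p)"
  proof (rule sum_mono)
    fix q assume "q \<in> {k\<^sub>1..<k\<^sub>2}"
    then show "h + a q \<le> h + a p" using strict_mono_onD[OF incr, of q p] ends by auto
  qed
  also have "\<dots> = e * (h + a p)" by (simp add: e_def)
  finally have "h \<le> e * a p" by (simp add: algebra_simps)
  moreover have "e * a p \<le> d * a p" using e by (intro mult_right_mono) auto
  moreover have "d * a p < h \<or> e * a p < h" using short by (simp only: d_def e_def)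
  ultimately show False by linarith
qed

text \<open>
The heart of the proof. Consider matched times that agree at stage \<open>n\<close> of \<open>R\<close> and, through \<open>Q\<close>,
inside blocks of the other system of length \<open>H\<close>, but disagree at stage \<open>n + 1\<close> of \<open>R\<close>. Each such
pair gets five labels: the numbers of the two \<open>H\<close>-blocks, of the two copies of tower \<open>n + 1\<close>, and of
the time window of length \<open>r * height R n\<close> to which it belongs. All five are monotone along the
matching, so two pairs with the same sum of labels have the same labels.

Such pairs have the same time shift, since the \<open>H\<close>-blocks of the two orbits are aligned. Hence they lie
in copies of tower \<open>n\<close> at the same distance inside the same two copies of tower \<open>n + 1\<close>. This distance
comes from different indices, because the pairs disagree at stage \<open>n + 1\<close>, and then
\<open>shifted_index_unique\<close> leaves room for a single copy of tower \<open>n\<close>. So at most \<open>height R n\<close> pairs share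
a sum of labels, and the number of sums is, up to rounding, the sum of the numbers of blocks and windows.
\<close>

lemma promotion:
  fixes R :: rank_one_system and M :: "(nat \<times> nat) set"
  assumes n: "1 \<le> n" "n < K"
    and hpos: "height R n > 0" "cuts R n > 0"
    and incr: "strict_mono_on {1..cuts R n} (spacers R n)"
    and r: "r > 0" "r * spacers R n (cuts R n) < height R n"
    and Q: "separated H Q" "H > 0"
    and M: "M \<subseteq> {..<N} \<times> {..<N}"
    and chain: "\<And>p q. p \<in> M \<Longrightarrow> q \<in> M \<Longrightarrow> fst p < fst q \<longleftrightarrow> snd p < snd q"
    and sync: "\<And>s t. (s, t) \<in> M \<Longrightarrow> synced R K n (x + s) (x' + t)"
    and nosync: "\<And>s t. (s, t) \<in> M \<Longrightarrow> \<not> synced R K (Suc n) (x + s) (x' + t)"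
    and other: "\<And>s t. (s, t) \<in> M \<Longrightarrow>
       \<exists>c\<in>Q. \<exists>c'\<in>Q. \<exists>k<H. y + s = c + k \<and> y' + t = c' + k"
  shows "card M \<le> height R n *
     (2 * (N div H + 2) + 2 * (N div height R (Suc n) + 2) + N div (r * height R n) + 1)"
proof -
  define h where "h = height R n"
  define h' where "h' = height R (Suc n)"
  define base where "base = subtower_base R n"
  define B where "B = Collect (block_start R K (Suc n))"
  have h'pos: "h' > 0"
    using hpos n height_Suc[of n R] unfolding h'_def by simp
  have sepB: "separated h' B"
    using block_start_separated unfolding separated_def B_def h'_def by auto
  have base_less: "base i + h \<le> base i'" if "1 \<le> i" "i < i'" for i i'
    using subtower_base_less that unfolding base_def h_def by blast
  have base_fit: "base i + h \<le> h'" if "i \<in> {1..cuts R n}" for i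
    using subtower_in_tower that n unfolding base_def h_def h'_def by blast
  have "\<exists>b b' i i' j. b \<in> B \<and> b' \<in> B \<and> i \<in> {1..cuts R n} \<and> i' \<in> {1..cuts R n} \<and> j < h \<and>
      x + fst p = b + base i + j \<and> x' + snd p = b' + base i' + j \<and> i \<noteq> i'" if p: "p \<in> M" for p
  proof -
    obtain d d' j where d: "block_start R K n d" "block_start R K n d'" "j < h"
      "x + fst p = d + j" "x' + snd p = d' + j"
      using sync[of "fst p" "snd p"] p unfolding synced_def h_def by auto
    obtain b i where b: "b \<in> B" "i \<in> {1..cuts R n}" "d = b + base i"
      using block_start_parent[OF d(1) n(2)] unfolding B_def base_def by blast
    obtain b' i' where b': "b' \<in> B" "i' \<in> {1..cuts R n}" "d' = b' + base i'"
      using block_start_parent[OF d(2) n(2)] unfolding B_def base_def by blast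
    have "i \<noteq> i'"
    proof
      assume "i = i'"
      then have "synced R K (Suc n) (x + fst p) (x' + snd p)"
        unfolding synced_def using b b' d base_fit[OF b(2)] unfolding B_def h'_def
        by (intro exI[of _ b] exI[of _ b'] exI[of _ "base i + j"]) auto
      then show False using nosync[of "fst p" "snd p"] p by simp
    qed
    moreover have "x + fst p = b + base i + j" "x' + snd p = b' + base i' + j"
      by (simp_all only: d(4,5) b(3) b'(3))
    ultimately show ?thesis using b(1,2) b'(1,2) d(3) by blast
  qed
  then have "\<forall>p\<in>M. \<exists>b b' i i' j. b \<in> B \<and> b' \<in> B \<and> i \<in> {1..cuts R n} \<and> i' \<in> {1..cuts R n} \<and>
      j < h \<and> x + fst p = b + base i + j \<and> x' + snd p = b' + base i' + j \<and> i \<noteq> i'"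
    by blast
  then obtain b b' i i' j where blocks: "\<forall>p\<in>M. b p \<in> B \<and> b' p \<in> B \<and> i p \<in> {1..cuts R n} \<and>
      i' p \<in> {1..cuts R n} \<and> j p < h \<and>
      x + fst p = b p + base (i p) + j p \<and> x' + snd p = b' p + base (i' p) + j p \<and> i p \<noteq> i' p"
    by (simp only: bchoice_iff) blast
  have "\<forall>p\<in>M. \<exists>c c' k. c \<in> Q \<and> c' \<in> Q \<and> k < H \<and> y + fst p = c + k \<and> y' + snd p = c' + k"
    using other by (metis prod.collapse)
  then obtain c c' k where "\<forall>p\<in>M. c p \<in> Q \<and> c' p \<in> Q \<and> k p < H \<and>
      y + fst p = c p + k p \<and> y' + snd p = c' p + k p"
    by (simp only: bchoice_iff) blast
  with blocks have w: "b p \<in> B" "b' p \<in> B" "i p \<in> {1..cuts R n}" "i' p \<in> {1..cuts R n}" "j p < h"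
    "x + fst p = b p + base (i p) + j p" "x' + snd p = b' p + base (i' p) + j p" "i p \<noteq> i' p"
    "c p \<in> Q" "c' p \<in> Q" "k p < H" "y + fst p = c p + k p" "y' + snd p = c' p + k p"
    if "p \<in> M" for p
    using that by simp_all
  have inB: "b p \<le> x + fst p" "x + fst p < b p + h'" "b' p \<le> x' + snd p" "x' + snd p < b' p + h'"
    if "p \<in> M" for p
    using w(3-7)[OF that] base_fit[of "i p"] base_fit[of "i' p"] by linarith+
  \<comment> \<open>The sum of the five labels.\<close>
  define F where "F p = (c p div H + 1) + (c' p div H + 1) + (b p div h' + 1) + (b' p div h' + 1)
     + fst p div (r * h)" for p
  define lo where "lo = y div H + y' div H + x div h' + x' div h'"
  define rg where "rg = 2 * (N div H + 2) + 2 * (N div h' + 2) + N div (r * h)"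
  have "F p \<in> {lo..lo + rg}" if p: "p \<in> M" for p
  proof -
    have N: "fst p < N" "snd p < N" using M p by auto
    have "fst p div (r * h) \<le> N div (r * h)" using N by (intro div_le_mono) simp
    then show ?thesis
      unfolding F_def lo_def rg_def
      using block_index_range[OF Q(2), of "c p" y "fst p" N] w(11,12)[OF p] 
         block_index_range[OF Q(2), of "c' p" y' "snd p" N] w(13)[OF p]
         block_index_range[OF h'pos, of "b p" x "fst p" N]
         block_index_range[OF h'pos, of "b' p" x' "snd p" N] inB[OF p] N
      by simp
  qed
  then have range: "F ` M \<subseteq> {lo..lo + rg}" by blast
  have key: "b p = b q \<and> i p = i q" if p: "p \<in> M" and q: "q \<in> M" and F: "F p = F q" and le: "fst p \<le> fst q" for p q
  proof -
    have le': "snd p \<le> snd q" using chain[OF q p] le by linarith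
    have cs: "c p \<le> c q" "c' p \<le> c' q"
      using separated_mono[OF Q(1), of "c p" "c q" "y + fst p" "y + fst q"]
        separated_mono[OF Q(1), of "c' p" "c' q" "y' + snd p" "y' + snd q"]
        w(9-13)[OF p] w(9-13)[OF q] le le' by auto
    have bs: "b p \<le> b q" "b' p \<le> b' q"
      using separated_mono[OF sepB, of "b p" "b q" "x + fst p" "x + fst q"]
        separated_mono[OF sepB, of "b' p" "b' q" "x' + snd p" "x' + snd q"]
        w(1,2)[OF p] w(1,2)[OF q] inB[OF p] inB[OF q] le le' by auto
    have "c p div H \<le> c q div H" "c' p div H \<le> c' q div H" "b p div h' \<le> b q div h'"
      "b' p div h' \<le> b' q div h'" "fst p div (r * h) \<le> fst q div (r * h)"
      using cs bs le by (auto intro: div_le_mono)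
    then have eqs: "c p div H = c q div H" "c' p div H = c' q div H" "b p div h' = b q div h'"
      "b' p div h' = b' q div h'" "fst p div (r * h) = fst q div (r * h)"
      using F unfolding F_def by linarith+
    have e: "c p = c q" "c' p = c' q" "b p = b q" "b' p = b' q"
      using separated_div_eq[OF Q(1) w(9)[OF p] w(9)[OF q] Q(2) eqs(1)]
        separated_div_eq[OF Q(1) w(10)[OF p] w(10)[OF q] Q(2) eqs(2)]
        separated_div_eq[OF sepB w(1)[OF p] w(1)[OF q] h'pos eqs(3)]
        separated_div_eq[OF sepB w(2)[OF p] w(2)[OF q] h'pos eqs(4)] by simp_all
    have near: "fst q < fst p + r * h"
    proof -
      have "fst q < fst q div (r * h) * (r * h) + r * h"
        using r hpos dividend_less_div_times[of "r * h" "fst q"] unfolding h_def by simp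
      also have "\<dots> \<le> fst p + r * h" using eqs(5) by (metis add_le_mono1 div_times_less_eq_dividend)
      finally show ?thesis .
    qed
    \<comment> \<open>Within common \<open>H\<close>-blocks the time shift is constant, hence so is the distance
      between the two copies of tower \<open>n\<close>.\<close>
    have off: "base (i q) + base (i' p) = base (i' q) + base (i p)"
      using w(6,7,12,13)[OF p] w(6,7,12,13)[OF q] e by linarith
    have ipq: "i p = i q"
    proof (rule ccontr)
      assume ne: "i p \<noteq> i q"
      \<comment> \<open>The two pairs would provide equidistant copies as in \<open>shifted_index_unique\<close>.\<close>
      have less: "i p < i q"
        using ne base_less[of "i q" "i p"] w(3,5,6)[OF p] w(3,5,6)[OF q] e(3) le by force
      have less': "i' p < i' q"
      proof (rule ccontr)
        assume "\<not> ?thesis"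
        then have "base (i' q) \<le> base (i' p)"
          using base_less[of "i' q" "i' p"] w(4)[OF q] by (cases "i' p = i' q") auto
        then show False using off base_less[of "i p" "i q"] less w(3)[OF p] hpos unfolding h_def by simp
      qed
      define a where "a = spacers R n"
      have diff: "base (i q) = base (i p) + (\<Sum>u=i p..<i q. h + a u)"
        "base (i' q) = base (i' p) + (\<Sum>u=i' p..<i' q. h + a u)"
        using subtower_base_diff[of "i p" "i q" R n] subtower_base_diff[of "i' p" "i' q" R n] less less'
          w(3,4)[OF p] unfolding base_def h_def a_def by simp_all
      have "(i q - i p) * h \<le> (\<Sum>u=i p..<i q. h + a u)" by (simp add: sum.distrib)
      then have "(i q - i p) * h < r * h + h"
        using diff(1) near w(5,6)[OF p] w(6)[OF q] e(3) by linarith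
      then have "(i q - i p) * h < (r + 1) * h" by simp
      then have "i q - i p \<le> r" by (metis mult_less_cancel2 Suc_eq_plus1 less_Suc_eq_le)
      then have "(i q - i p) * a (cuts R n) \<le> r * a (cuts R n)" by (rule mult_right_mono) simp
      then have short: "(i q - i p) * a (cuts R n) < h" using r(2) unfolding a_def h_def by linarith
      have eq: "(\<Sum>u=i p..<i q. h + a u) = (\<Sum>u=i' p..<i' q. h + a u)"
        using diff off by linarith
      show False
      proof (cases "i p < i' p")
        case True
        then show False
          using shifted_index_unique[of "cuts R n" a "i p" "i q" "i' p" "i' q" h]
            incr less less' eq short w(3,4)[OF p] w(3,4)[OF q] unfolding a_def by simp
      next
        case False
        then have "i' p < i p" using w(8)[OF p] by simp
        then show False
          using shifted_index_unique[of "cuts R n" a "i' p" "i' q" "i p" "i q" h]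
            incr less less' eq short w(3,4)[OF p] w(3,4)[OF q] unfolding a_def by simp
      qed
    qed
    then show ?thesis using e by simp
  qed
  have fibre: "card {q \<in> M. F q = F p} \<le> h" if p: "p \<in> M" for p
  proof -
    have "inj_on j {q \<in> M. F q = F p}"
    proof (rule inj_onI)
      fix q q' assume q: "q \<in> {q \<in> M. F q = F p}" "q' \<in> {q \<in> M. F q = F p}" "j q = j q'"
      have "b q = b q' \<and> i q = i q'" using key[of q q'] key[of q' q] q by force
      then have "fst q = fst q'" using w(6)[of q] w(6)[of q'] q by simp
      moreover have "snd q = snd q'" using chain[of q q'] chain[of q' q] q calculation by force
      ultimately show "q = q'" by (rule prod_eqI)
    qed
    moreover have "j ` {q \<in> M. F q = F p} \<subseteq> {..<h}" using w(5) by auto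
    ultimately show ?thesis using card_inj_on_le[of j "{q \<in> M. F q = F p}" "{..<h}"] by simp
  qed
  have "finite M" using M finite_subset by blast
  from card_le_fibres[OF this range fibre] show ?thesis
    unfolding rg_def h_def h'_def by simp
qed

section \<open>Climbing both sequences of towers\<close>

definition staircase :: "real \<Rightarrow> real \<Rightarrow> rank_one_system \<Rightarrow> nat \<Rightarrow> bool" where
  "staircase \<gamma> \<gamma>' R n \<longleftrightarrow> real (height R n) powr \<gamma> \<le> real (cuts R n) \<and>
     (\<forall>i\<in>{2..cuts R n}. spacers R n (i - 1) < spacers R n i) \<and>
     real (spacers R n (cuts R n)) \<le> real (height R n) powr \<gamma>'"

lemma strict_mono_on_interval:
  fixes a :: "nat \<Rightarrow> nat"
  assumes "\<forall>i\<in>{2..p}. a (i - 1) < a i"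
  shows "strict_mono_on {1..p} a"
proof (rule strict_mono_onI)
  fix i i' assume i: "i \<in> {1..p}" "i' \<in> {1..p}" "i < i'"
  have "i < i' \<Longrightarrow> 1 \<le> i \<and> i' \<le> p \<longrightarrow> a i < a i'"
  proof (induction rule: less_Suc_induct)
    case (1 i)
    then show ?case using assms by (auto dest!: bspec[of _ _ "Suc i"])
  qed force
  then show "a i < a i'" using i by auto
qed

text \<open>
The bound of \<open>promotion\<close> in terms of the height \<open>h\<close> of stage \<open>n\<close>: the block lengths \<open>H\<close> and
\<open>height R (Suc n)\<close> exceed \<open>h\<close> by at least the factor \<open>h powr \<beta>\<close>, and the window may contain about
\<open>h powr (1 - \<gamma>')\<close> copies of tower \<open>n\<close>, because its spacers have size at most \<open>h powr \<gamma>'\<close>.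
\<close>

lemma promotion_cost:
  fixes R :: rank_one_system and M :: "(nat \<times> nat) set" and \<beta> \<gamma> \<gamma>' :: real
  assumes \<beta>: "0 < \<beta>" "\<beta> \<le> \<gamma>" "\<beta> \<le> 1 - \<gamma>'"
    and n: "1 \<le> n" "n < K"
    and cuts: "\<forall>n\<ge>1. 1 < cuts R n"
    and stair: "staircase \<gamma> \<gamma>' R n" and large: "2 \<le> real (height R n) powr (1 - \<gamma>')"
    and Q: "separated H Q"
    and gap: "real (height R n) powr (1 + \<beta>) \<le> real H"
    and N: "real (height R n) powr (1 + \<beta>) \<le> 16 * real N"
    and M: "M \<subseteq> {..<N} \<times> {..<N}"
    and chain: "\<And>p q. p \<in> M \<Longrightarrow> q \<in> M \<Longrightarrow> fst p < fst q \<longleftrightarrow> snd p < snd q"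
    and sync: "\<And>s t. (s, t) \<in> M \<Longrightarrow> synced R K n (x + s) (x' + t)"
    and nosync: "\<And>s t. (s, t) \<in> M \<Longrightarrow> \<not> synced R K (Suc n) (x + s) (x' + t)"
    and other: "\<And>s t. (s, t) \<in> M \<Longrightarrow>
       \<exists>c\<in>Q. \<exists>c'\<in>Q. \<exists>k<H. y + s = c + k \<and> y' + t = c' + k"
  shows "real (card M) \<le> 150 * real N * real (height R n) powr (- \<beta>)"
proof -
  define h where "h = real (height R n)"
  define h' where "h' = real (height R (Suc n))"
  define z where "z = h powr \<beta>"
  have hpos: "height R n > 0" using height_pos[OF cuts n(1)] .
  then have h1: "h \<ge> 1" unfolding h_def by simp
  then have z1: "z \<ge> 1" using \<beta> unfolding z_def by (simp add: ge_one_powr_ge_zero)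
  have hz: "h powr (1 + \<beta>) = h * z" using h1 unfolding z_def by (simp add: powr_add)
  have Hge: "h * z \<le> H" using gap hz unfolding h_def by simp
  have Nge: "h * z \<le> 16 * N" using N hz unfolding h_def by simp
  have h'ge: "h * z \<le> h'"
  proof -
    have "z \<le> h powr \<gamma>" unfolding z_def using h1 \<beta> by (intro powr_mono) auto
    also have "\<dots> \<le> cuts R n" using stair unfolding staircase_def h_def by simp
    finally have "h * z \<le> h * cuts R n" using h1 by simp
    also have "\<dots> \<le> h'" unfolding h_def h'_def height_Suc[OF n(1)] by (simp add: sum_nonneg)
    finally show ?thesis .
  qed
  define w where "w = h powr (1 - \<gamma>')"
  \<comment> \<open>The largest integer below \<open>w\<close>: the spacers of fewer than \<open>w\<close> copies do not add up to a height.\<close>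
  define r where "r = nat \<lceil>w\<rceil> - 1"
  have w2: "w \<ge> 2" using large unfolding w_def h_def .
  have rw: "real r < w" "w / 2 \<le> real r" unfolding r_def using w2 by linarith+
  have r0: "r > 0" using rw w2 by (intro gr0I) simp
  have "z \<le> w" unfolding z_def w_def using h1 \<beta> by (intro powr_mono) auto
  then have zr: "z \<le> 2 * r" using rw by simp
  have "real r * spacers R n (cuts R n) \<le> real r * h powr \<gamma>'"
    using stair unfolding staircase_def h_def by (intro mult_left_mono) auto
  also have "\<dots> < w * h powr \<gamma>'" using rw h1 by (intro mult_strict_right_mono) auto
  also have "\<dots> = h" unfolding w_def using h1 by (simp flip: powr_add)
  finally have ra: "r * spacers R n (cuts R n) < height R n"
    unfolding h_def by (metis of_nat_less_iff of_nat_mult)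
  have "h * z \<ge> 1" using mult_mono[OF h1 z1] h1 by simp
  then have pos: "h > 0" "z > 0" "real H > 0" "h' > 0" "real r > 0" "h * z > 0"
    using h1 z1 Hge h'ge r0 by linarith+
  have H0: "H > 0" using pos by simp
  have c0: "cuts R n > 0" using cuts n by auto
  have "card M \<le> height R n *
     (2 * (N div H + 2) + 2 * (N div height R (Suc n) + 2) + N div (r * height R n) + 1)"
    by (rule promotion[OF n hpos c0 _ r0 ra Q H0 M chain sync nosync other])
      (use stair strict_mono_on_interval in \<open>auto simp: staircase_def\<close>)
  then have "real (card M) \<le> real (height R n *
     (2 * (N div H + 2) + 2 * (N div height R (Suc n) + 2) + N div (r * height R n) + 1))"
    by (rule of_nat_mono)
  also have "\<dots> = h * (2 * (real (N div H) + 2) + 2 * (real (N div height R (Suc n)) + 2) 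
     + real (N div (r * height R n)) + 1)"
    unfolding h_def by (simp add: algebra_simps)
  also have "\<dots> \<le> h * (2 * (N / H + 2) + 2 * (N / h' + 2) + N / (r * h) + 1)"
  proof -
    have "real (N div H) \<le> N / H" "real (N div height R (Suc n)) \<le> N / h'"
      "real (N div (r * height R n)) \<le> N / (r * h)"
      unfolding h'_def h_def using of_nat_div_le_of_nat[of N] by (simp_all only: of_nat_mult[symmetric])
    then show ?thesis using pos by (intro mult_left_mono) auto
  qed
  \<comment> \<open>The rounding terms contribute \<open>9 * h\<close>, which is at most \<open>144 * N / z\<close>; in all this gives 150.\<close>
  also have "\<dots> = 2 * N * (h / H) + 2 * N * (h / h') + N * (1 / r) + 9 * h"
    using pos by (simp add: field_simps)
  also have "\<dots> \<le> 2 * N * (1 / z) + 2 * N * (1 / z) + N * (2 / z) + 9 * (16 * N * (1 / z))"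
  proof -
    have "h / H \<le> h / (h * z)" "h / h' \<le> h / (h * z)"
      by (rule divide_left_mono; use pos Hge h'ge in \<open>simp only: mult_pos_pos less_imp_le\<close>)+
    then have "h / H \<le> 1 / z" "h / h' \<le> 1 / z" using pos by simp_all
    moreover have "1 / r \<le> 2 / z" "h \<le> 16 * N * (1 / z)"
      using pos zr Nge by (simp_all add: field_simps)
    ultimately show ?thesis by (intro add_mono mult_left_mono) auto
  qed
  also have "\<dots> = 150 * real N * (1 / z)" by (simp add: field_simps)
  also have "1 / z = h powr (-\<beta>)" unfolding z_def by (simp add: powr_minus_divide)
  finally show ?thesis unfolding h_def .
qed

text \<open>
Heights at least double from one stage to the next, so this is a geometric majorant of the sum of
\<open>real (height R k) powr (- \<beta>)\<close> over \<open>k \<ge> n\<close>.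
\<close>

definition tail :: "real \<Rightarrow> rank_one_system \<Rightarrow> nat \<Rightarrow> real" where
  "tail \<beta> R n = real (height R n) powr (- \<beta>) / (1 - 2 powr (- \<beta>))"

lemma tail_nonneg: "\<beta> > 0 \<Longrightarrow> tail \<beta> R n \<ge> 0"
  unfolding tail_def using powr_less_mono[of "-\<beta>" 0 2] by (intro divide_nonneg_nonneg) auto

lemma tail_step:
  assumes "\<beta> > 0" "\<forall>n\<ge>1. 1 < cuts R n" "n \<ge> 1"
  shows "real (height R n) powr (- \<beta>) + tail \<beta> R (Suc n) \<le> tail \<beta> R n"
proof -
  define h where "h = real (height R n)"
  have "h > 0" using height_pos[OF assms(2,3)] unfolding h_def by simp
  have "2 powr (-\<beta>) < (1::real)" using powr_less_mono[of "-\<beta>" 0 2] assms(1) by simp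
  then have d: "1 - 2 powr (-\<beta>) > (0::real)" by simp
  have "2 * h \<le> height R (Suc n)" using height_double[OF assms(2,3)] unfolding h_def by simp
  then have "real (height R (Suc n)) powr (-\<beta>) \<le> (2 * h) powr (-\<beta>)"
    using \<open>h > 0\<close> assms(1) by (intro powr_mono2') auto
  also have "\<dots> = 2 powr (-\<beta>) * h powr (-\<beta>)" using \<open>h > 0\<close> by (simp add: powr_mult)
  finally have "h powr (-\<beta>) * (1 - 2 powr (-\<beta>)) + real (height R (Suc n)) powr (-\<beta>) \<le> h powr (-\<beta>)"
    by (simp add: algebra_simps)
  then have "(h powr (-\<beta>) * (1 - 2 powr (-\<beta>)) + real (height R (Suc n)) powr (-\<beta>)) / (1 - 2 powr (-\<beta>))
      \<le> h powr (-\<beta>) / (1 - 2 powr (-\<beta>))"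
    using d by (intro divide_right_mono) auto
  then show ?thesis unfolding tail_def h_def[symmetric] using d assms(1) by (simp add: add_divide_distrib)
qed

lemma separated_block_starts: "separated (height R n) (Collect (block_start R K n))"
  using block_start_separated unfolding separated_def by auto

lemma synced_other:
  "synced R K n l l' \<Longrightarrow> \<exists>c\<in>Collect (block_start R K n). \<exists>c'\<in>Collect (block_start R K n).
     \<exists>k<height R n. l = c + k \<and> l' = c' + k"
  unfolding synced_def by auto

text \<open>
Of the two current towers the lower one is always promoted; by the gap hypotheses the other tower is
then much higher, as \<open>promotion_cost\<close> requires. The costs of all promotions add up to the tails. The
process ends at stage \<open>K\<close> of \<open>T\<close>, where no pair is synchronised: there is only one copy of tower \<open>K\<close>,
and the positions \<open>x + s\<close> and \<open>x' + t\<close> differ, because \<open>x + N \<le> x'\<close> and \<open>s < N\<close>.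
\<close>

lemma few_synced_pairs:
  fixes T S :: rank_one_system and M :: "(nat \<times> nat) set" and \<beta> \<gamma> \<gamma>' :: real
  assumes \<beta>: "0 < \<beta>" "\<beta> \<le> \<gamma>" "\<beta> \<le> 1 - \<gamma>'"
    and cuts: "\<forall>n\<ge>1. 1 < cuts T n" "\<forall>m\<ge>1. 1 < cuts S m"
    and start: "1 \<le> n\<^sub>0" "1 \<le> m\<^sub>0"
    and stair: "\<And>n. n \<ge> n\<^sub>0 \<Longrightarrow> staircase \<gamma> \<gamma>' T n" "\<And>m. m \<ge> m\<^sub>0 \<Longrightarrow> staircase \<gamma> \<gamma>' S m"
    and large: "\<And>n. n \<ge> n\<^sub>0 \<Longrightarrow> 2 \<le> real (height T n) powr (1 - \<gamma>')" 
      "\<And>m. m \<ge> m\<^sub>0 \<Longrightarrow> 2 \<le> real (height S m) powr (1 - \<gamma>')"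
    and gap: "\<And>n m. n \<ge> n\<^sub>0 \<Longrightarrow> m \<ge> m\<^sub>0 \<Longrightarrow> height T n < height S m \<Longrightarrow>
        real (height T n) powr (1 + \<beta>) \<le> real (height S m)"
      "\<And>n m. n \<ge> n\<^sub>0 \<Longrightarrow> m \<ge> m\<^sub>0 \<Longrightarrow> height S m \<le> height T n \<Longrightarrow>
        real (height S m) powr (1 + \<beta>) \<le> real (height T n)"
    and KL: "height T K < height S L" and N: "height T K \<le> 16 * N"
    and apart: "x + N \<le> x'"
    and M: "M \<subseteq> {..<N} \<times> {..<N}"
    and chain: "\<And>p q. p \<in> M \<Longrightarrow> q \<in> M \<Longrightarrow> fst p < fst q \<longleftrightarrow> snd p < snd q"
    and nm: "n\<^sub>0 \<le> n" "n \<le> K" "m\<^sub>0 \<le> m" "m \<le> L"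
  shows "real (card {(s, t) \<in> M. synced T K n (x + s) (x' + t) \<and> synced S L m (y + s) (y' + t)})
     \<le> 150 * real N * (tail \<beta> T n + tail \<beta> S m)"
  using nm
proof (induction "K - n + (L - m)" arbitrary: n m rule: less_induct)
  case less
  define G where "G n m = {(s, t) \<in> M. synced T K n (x + s) (x' + t) \<and> synced S L m (y + s) (y' + t)}" for n m
  have IH: "real (card (G n' m')) \<le> 150 * real N * (tail \<beta> T n' + tail \<beta> S m')"
    if "K - n' + (L - m') < K - n + (L - m)" "n\<^sub>0 \<le> n'" "n' \<le> K" "m\<^sub>0 \<le> m'" "m' \<le> L" for n' m'
    using less.hyps[OF that] unfolding G_def .
  have finM: "finite M" using M finite_subset by blast
  have finG: "finite (G n m)" for n m
    using finM by (rule rev_finite_subset) (auto simp: G_def)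
  have cardG: "real (card (G n m)) \<le> real (card (G n' m')) + real (card (G n m - G n' m'))" for n' m'
  proof -
    have "card (G n m) \<le> card (G n' m' \<union> (G n m - G n' m'))" using finG by (intro card_mono) auto
    also have "\<dots> \<le> card (G n' m') + card (G n m - G n' m')" by (rule card_Un_le)
    finally show ?thesis by linarith
  qed
  have GM: "G n m - G n' m' \<subseteq> {..<N} \<times> {..<N}" for n' m' using M unfolding G_def by auto
  have chain': "fst p < fst q \<longleftrightarrow> snd p < snd q" if "p \<in> G n m - G n' m'" "q \<in> G n m - G n' m'" for n' m' p q
    using chain[of p q] that unfolding G_def by auto
  have n1: "n \<ge> 1" "m \<ge> 1" using less.prems start by auto
  have "real (card (G n m)) \<le> 150 * real N * (tail \<beta> T n + tail \<beta> S m)"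
  proof (cases "n = K")
    case True
    have "G n m = {}"
      unfolding G_def synced_def True block_start_top using apart M by auto
    then show ?thesis using tail_nonneg[OF \<beta>(1)] by simp
  next
    case False
    then have nK: "n < K" using less.prems by simp
    have hK: "height T (Suc n) \<le> height T K" "height T n < height T K"
      using height_mono[OF cuts(1), of "Suc n" K] height_strict_mono[OF cuts(1), of n K] nK n1 by auto
    have NT: "real (height T K) \<le> 16 * N" using N by linarith
    show ?thesis
    proof (cases "height T n < height S m")
      case True
      have hn: "real (height T n) powr (1 + \<beta>) \<le> real (height T (Suc n))"
      proof -
        have h1: "real (height T n) \<ge> 1" using height_pos[OF cuts(1) n1(1)] by simp
        then have "real (height T n) powr (1 + \<beta>) = real (height T n) * real (height T n) powr \<beta>" 
          by (simp add: powr_add)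
        also have "\<dots> \<le> real (height T n) * real (height T n) powr \<gamma>"
          using h1 \<beta> by (intro mult_left_mono powr_mono) auto
        also have "\<dots> \<le> real (height T n) * cuts T n"
          using stair(1)[of n] less.prems unfolding staircase_def by (intro mult_left_mono) auto
        also have "\<dots> \<le> height T (Suc n)" unfolding height_Suc[OF n1(1)] by (simp add: sum_nonneg)
        finally show ?thesis .
      qed
      have "real (card (G n m - G (Suc n) m)) \<le> 150 * real N * real (height T n) powr (- \<beta>)"
      proof (rule promotion_cost[OF \<beta> n1(1) nK cuts(1) _ _ separated_block_starts[of S m L] _ _ GM chain'])
        show "real (height T n) powr (1 + \<beta>) \<le> real (height S m)" using gap(1) True less.prems by simp
        show "real (height T n) powr (1 + \<beta>) \<le> 16 * real N" using hn hK NT by linarith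
      qed (use stair large less.prems synced_other in \<open>auto simp: G_def\<close>)
      moreover have "real (card (G (Suc n) m)) \<le> 150 * real N * (tail \<beta> T (Suc n) + tail \<beta> S m)"
        using less.prems nK by (intro IH) auto
      moreover have "150 * real N * (real (height T n) powr (- \<beta>) + tail \<beta> T (Suc n)) \<le> 150 * real N * tail \<beta> T n"
        using tail_step[OF \<beta>(1) cuts(1) n1(1)] by (intro mult_left_mono) auto
      ultimately show ?thesis using cardG[of "Suc n" m] by (simp only: distrib_left)
    next
      case False
      then have le: "height S m \<le> height T n" by simp
      have "m \<noteq> L" using le hK KL by auto
      then have mL: "m < L" using less.prems by simp
      have hm: "real (height S m) powr (1 + \<beta>) \<le> real (height T n)" using gap(2) le less.prems by simp
      have "real (card (G n m - G n (Suc m))) \<le> 150 * real N * real (height S m) powr (- \<beta>)"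
      proof (rule promotion_cost[OF \<beta> n1(2) mL cuts(2) _ _ separated_block_starts[of T n K] _ _ GM chain'])
        show "real (height S m) powr (1 + \<beta>) \<le> real (height T n)" by (rule hm)
        show "real (height S m) powr (1 + \<beta>) \<le> 16 * real N" using hm hK NT by linarith
      qed (use stair large less.prems synced_other in \<open>auto simp: G_def\<close>)
      moreover have "real (card (G n (Suc m))) \<le> 150 * real N * (tail \<beta> T n + tail \<beta> S (Suc m))"
        using less.prems mL by (intro IH) auto
      moreover have "150 * real N * (real (height S m) powr (- \<beta>) + tail \<beta> S (Suc m)) \<le> 150 * real N * tail \<beta> S m"
        using tail_step[OF \<beta>(1) cuts(2) n1(2)] by (intro mult_left_mono) auto
      ultimately show ?thesis using cardG[of n "Suc m"] by (simp only: distrib_left)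
    qed
  qed
  then show ?case unfolding G_def .
qed

section \<open>Levels, orbits and measure\<close>

lemma rank_oneD:
  assumes "R \<in> rank_one"
  shows "\<forall>n\<ge>1. 1 < cuts R n"
    and "n \<ge> 1 \<Longrightarrow> disjoint_family_on (level R n) {..<height R n}"
    and "n \<ge> 1 \<Longrightarrow> i \<in> {1..cuts R n} \<Longrightarrow> j < height R n \<Longrightarrow>
        left_end R (Suc n) (subtower_base R n i + j) = left_end R n j + (real i - 1) * width R (Suc n)"
    and "n \<ge> 1 \<Longrightarrow> j + 1 < height R n \<Longrightarrow> x \<in> level R n j \<Longrightarrow>
        transf R x = x + (left_end R n (j + 1) - left_end R n j)"
    and "summable (\<lambda>n. 1 / (\<Prod>k=1..n+1. real (cuts R k)) * (\<Sum>i=1..cuts R (n+1). real (spacers R (n+1) i)))"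
  using assms unfolding rank_one_def by (auto simp: Let_def)

lemma width_pos: "R \<in> rank_one \<Longrightarrow> width R n > 0"
  unfolding width_def using rank_oneD(1)[of R] by (force intro!: divide_pos_pos prod_pos)

lemma width_Suc:
  assumes "R \<in> rank_one" "n \<ge> 1"
  shows "width R n = cuts R n * width R (Suc n)"
proof -
  have "cuts R n > 0" using rank_oneD(1)[OF assms(1)] assms(2) by auto
  then show ?thesis unfolding width_def using assms(2) by (simp add: prod.atLeastLessThan_Suc)
qed

lemma level_split:
  assumes R: "R \<in> rank_one" and n: "n \<ge> 1" and j: "j < height R n"
  shows "level R n j = (\<Union>i\<in>{1..cuts R n}. level R (Suc n) (subtower_base R n i + j))"
proof -
  define a where "a = left_end R n j"
  define w where "w = width R (Suc n)"
  have w: "w > 0" using width_pos[OF R] unfolding w_def .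
  have sub: "level R (Suc n) (subtower_base R n i + j) = {a + (real i - 1) * w ..< a + real i * w}"
    if "i \<in> {1..cuts R n}" for i
    using rank_oneD(3)[OF R n that j] unfolding level_def a_def w_def
    by (intro arg_cong2[where f = atLeastLessThan]) (simp_all add: algebra_simps)
  have "level R n j = {a..<a + cuts R n * w}"
    unfolding level_def a_def w_def using width_Suc[OF R n] by simp
  also have "\<dots> = (\<Union>i\<in>{1..cuts R n}. {a + (real i - 1) * w ..< a + real i * w})"
  proof (intro equalityI subsetI)
    fix z assume z: "z \<in> {a..<a + cuts R n * w}"
    define i where "i = nat \<lfloor>(z - a) / w\<rfloor> + 1"
    have q: "0 \<le> (z - a) / w" "(z - a) / w < cuts R n" using z w by (auto simp: field_simps)
    then have i: "real i - 1 \<le> (z - a) / w" "(z - a) / w < real i" unfolding i_def by linarith+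
    then have "z \<in> {a + (real i - 1) * w ..< a + real i * w}" using w by (auto simp: field_simps)
    moreover have "i \<in> {1..cuts R n}" using i q unfolding i_def by simp linarith
    ultimately show "z \<in> (\<Union>i\<in>{1..cuts R n}. {a + (real i - 1) * w ..< a + real i * w})" by blast
  next
    fix z assume "z \<in> (\<Union>i\<in>{1..cuts R n}. {a + (real i - 1) * w ..< a + real i * w})"
    then obtain i where i: "1 \<le> i" "i \<le> cuts R n" "a + (real i - 1) * w \<le> z" "z < a + real i * w" by auto
    have "0 \<le> (real i - 1) * w" "real i * w \<le> cuts R n * w" using i w by (auto intro: mult_right_mono)
    then show "z \<in> {a..<a + cuts R n * w}" using i by auto
  qed
  finally show ?thesis using sub by simp
qed

lemma level_blocks:
  assumes R: "R \<in> rank_one" and n: "1 \<le> n" "n \<le> K" and j: "j < height R n"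
  shows "level R n j = (\<Union>b\<in>Collect (block_start R K n). level R K (b + j))"
  using n(2,1) j
proof (induction n arbitrary: j rule: inc_induct)
  case base
  then show ?case by (simp add: block_start_top)
next
  case (step n)
  have fit: "subtower_base R n i + j < height R (Suc n)" if "i \<in> {1..cuts R n}" for i
    using subtower_in_tower[of n i R] that step.prems by simp
  have "level R n j = (\<Union>i\<in>{1..cuts R n}. level R (Suc n) (subtower_base R n i + j))"
    using level_split[OF R] step.prems by simp
  also have "\<dots> = (\<Union>i\<in>{1..cuts R n}. \<Union>b\<in>Collect (block_start R K (Suc n)). level R K (b + (subtower_base R n i + j)))"
    using step.IH fit by simp
  also have "\<dots> = (\<Union>b\<in>Collect (block_start R K n). level R K (b + j))"
  proof (intro equalityI subsetI)
    fix z assume "z \<in> (\<Union>i\<in>{1..cuts R n}. \<Union>b\<in>Collect (block_start R K (Suc n)). level R K (b + (subtower_base R n i + j)))"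
    then obtain i b where "i \<in> {1..cuts R n}" "block_start R K (Suc n) b"
      "z \<in> level R K (b + (subtower_base R n i + j))" by auto
    then show "z \<in> (\<Union>b\<in>Collect (block_start R K n). level R K (b + j))"
      using block_start.subtower[of R K n b i] step.prems by (auto simp: add.assoc)
  next
    fix z assume "z \<in> (\<Union>b\<in>Collect (block_start R K n). level R K (b + j))"
    then obtain b where b: "block_start R K n b" "z \<in> level R K (b + j)" by auto
    from block_start_parent[OF b(1) step.hyps(2)] b(2)
    show "z \<in> (\<Union>i\<in>{1..cuts R n}. \<Union>b\<in>Collect (block_start R K (Suc n)). level R K (b + (subtower_base R n i + j)))"
      by (metis (no_types, lifting) UN_I add.assoc mem_Collect_eq)
  qed
  finally show ?case .
qed

text \<open>
Which level of tower \<open>n\<close> a point is on can be read off from its level in tower \<open>K\<close>. This turns matched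
letters into synchronised positions.
\<close>

lemma level_position:
  assumes R: "R \<in> rank_one" and n: "1 \<le> n" "n \<le> K" and j: "j < height R n" and z: "z \<in> level R n j"
    and l: "l < height R K" "z \<in> level R K l"
  obtains b where "block_start R K n b" "l = b + j"
proof -
  obtain b where b: "block_start R K n b" "z \<in> level R K (b + j)"
    using level_blocks[OF R n j] z by auto
  have "b + j < height R K" using block_start_fits[OF b(1)] j by simp
  then have "b + j = l"
    using rank_oneD(2)[OF R, of K] n l b(2) unfolding disjoint_family_on_def by fastforce
  then show thesis using that b by blast
qed

lemma orbit_in_level:
  assumes R: "R \<in> rank_one" and K: "K \<ge> 1" and x: "x \<in> level R K i" and s: "i + s < height R K"
  shows "(transf R ^^ s) x \<in> level R K (i + s)"
  using s
proof (induction s)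
  case (Suc s)
  then have "(transf R ^^ s) x \<in> level R K (i + s)" by simp
  moreover have "i + s + 1 < height R K" using Suc by simp
  ultimately show ?case
    using rank_oneD(4)[OF R K, of "i + s" "(transf R ^^ s) x"] unfolding level_def by simp
qed (use x in simp)

text \<open>
The levels of tower \<open>K\<close> that are contained in tower \<open>n\<close>; \<open>outside\<close> below consists of the others.
\<close>

definition inside :: "rank_one_system \<Rightarrow> nat \<Rightarrow> nat \<Rightarrow> nat set" where
  "inside R K n = (\<Union>j<height R n. (\<lambda>b. b + j) ` Collect (block_start R K n))"

lemma inside_subset: "inside R K n \<subseteq> {..<height R K}"
  unfolding inside_def using block_start_fits[of R K n] by force

lemma tower_blocks:
  assumes R: "R \<in> rank_one" and n: "1 \<le> n" "n \<le> K"
  shows "tower R n = (\<Union>l\<in>inside R K n. level R K l)"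
proof -
  have "tower R n = (\<Union>j<height R n. \<Union>b\<in>Collect (block_start R K n). level R K (b + j))"
    unfolding tower_def using level_blocks[OF R n] by (intro SUP_cong) simp_all
  also have "\<dots> = (\<Union>l\<in>inside R K n. level R K l)" unfolding inside_def by simp
  finally show ?thesis .
qed

lemma tower_mono:
  assumes R: "R \<in> rank_one" and n: "1 \<le> n" "n \<le> K"
  shows "tower R n \<subseteq> tower R K"
  unfolding tower_blocks[OF R n] unfolding tower_def using inside_subset by (intro UN_mono) auto

lemma level_subset_total: "n \<ge> 1 \<Longrightarrow> j < height R n \<Longrightarrow> level R n j \<subseteq> total_space R"
  unfolding total_space_def tower_def by auto

lemma emeasure_levels:
  assumes R: "R \<in> rank_one" and n: "1 \<le> n" and I: "I \<subseteq> {..<height R n}"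
  shows "(\<Union>j\<in>I. level R n j) \<in> sets lborel"
    and "emeasure lborel (\<Union>j\<in>I. level R n j) = ennreal (card I * width R n)"
proof -
  have fin: "finite I" using I finite_subset by blast
  then show "(\<Union>j\<in>I. level R n j) \<in> sets lborel" unfolding level_def by auto
  have "disjoint_family_on (level R n) I"
    using rank_oneD(2)[OF R n] I by (rule disjoint_family_on_mono[rotated])
  then have "emeasure lborel (\<Union>j\<in>I. level R n j) = (\<Sum>j\<in>I. emeasure lborel (level R n j))"
    using fin by (intro sum_emeasure[symmetric]) (auto simp: level_def[abs_def])
  also have "\<dots> = (\<Sum>j\<in>I. ennreal (width R n))"
    using width_pos[OF R, of n] by (intro sum.cong) (auto simp: level_def)
  also have "\<dots> = ennreal (card I * width R n)"
    using width_pos[OF R, of n] by (simp add: ennreal_mult ennreal_of_nat_eq_real_of_nat)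
  finally show "emeasure lborel (\<Union>j\<in>I. level R n j) = ennreal (card I * width R n)" .
qed

definition volume :: "rank_one_system \<Rightarrow> real" where
  "volume R = measure lborel (total_space R)"

text \<open>
The summands are the measures of the spacers added at the successive stages.
\<close>

lemma tower_measure_Suc:
  assumes R: "R \<in> rank_one"
  shows "height R (Suc n) * width R (Suc n)
    = 1 + (\<Sum>m<n. 1 / (\<Prod>k=1..m+1. real (cuts R k)) * (\<Sum>i=1..cuts R (m+1). real (spacers R (m+1) i)))"
proof (induction n)
  case 0
  then show ?case by (simp add: width_def)
next
  case (Suc n)
  have "real (height R (Suc (Suc n))) * width R (Suc (Suc n)) =
     height R (Suc n) * width R (Suc n) + width R (Suc (Suc n)) * (\<Sum>i=1..cuts R (n+1). real (spacers R (n+1) i))"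
    using width_Suc[OF R, of "Suc n"] by (simp add: algebra_simps)
  moreover have "width R (Suc (Suc n)) = 1 / (\<Prod>k=1..n+1. real (cuts R k))"
    unfolding width_def by (simp add: atLeastLessThanSuc_atLeastAtMost)
  ultimately show ?case using Suc by simp
qed

lemma volume_total_space:
  assumes R: "R \<in> rank_one"
  shows "total_space R \<in> sets lborel"
    and "emeasure lborel (total_space R) = ennreal (volume R)"
    and "volume R > 0"
    and "(\<lambda>n. height R (Suc n) * width R (Suc n)) \<longlonglongrightarrow> volume R"
    and "\<forall>n\<ge>1. height R n * width R n \<le> volume R"
proof -
  define f where "f m = 1 / (\<Prod>k=1..m+1. real (cuts R k)) * (\<Sum>i=1..cuts R (m+1). real (spacers R (m+1) i))" for m
  define V where "V = 1 + suminf f"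
  have sf: "summable f" using rank_oneD(5)[OF R] unfolding f_def .
  have f0: "f m \<ge> 0" for m unfolding f_def by (intro mult_nonneg_nonneg divide_nonneg_nonneg prod_nonneg sum_nonneg) auto
  have tm: "height R (Suc n) * width R (Suc n) = 1 + sum f {..<n}" for n
    using tower_measure_Suc[OF R] unfolding f_def .
  have lim: "(\<lambda>n. height R (Suc n) * width R (Suc n)) \<longlonglongrightarrow> V"
    unfolding tm V_def using sf by (intro tendsto_intros summable_LIMSEQ)
  have le: "height R n * width R n \<le> V" if "n \<ge> 1" for n
    using sum_le_suminf[OF sf, of "{..<n-1}"] f0 tm[of "n - 1"] that unfolding V_def by simp
  have tower: "tower R n \<in> sets lborel" "emeasure lborel (tower R n) = ennreal (height R n * width R n)" if "n \<ge> 1" for n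
    using emeasure_levels[OF R that, of "{..<height R n}"] unfolding tower_def by auto
  have total: "total_space R = (\<Union>n. tower R (Suc n))"
    unfolding total_space_def by (auto simp: Suc_le_eq gr0_conv_Suc)
  then show st: "total_space R \<in> sets lborel" using tower(1) by auto
  have "(\<lambda>n. emeasure lborel (tower R (Suc n))) \<longlonglongrightarrow> emeasure lborel (total_space R)"
    unfolding total using tower tower_mono[OF R] by (intro Lim_emeasure_incseq incseq_SucI) auto
  moreover have "(\<lambda>n. emeasure lborel (tower R (Suc n))) \<longlonglongrightarrow> ennreal V"
    using tower(2) lim by (auto intro: tendsto_ennrealI)
  ultimately have em: "emeasure lborel (total_space R) = ennreal V" using LIMSEQ_unique by blast
  have V1: "V \<ge> 1" unfolding V_def using suminf_nonneg[OF sf] f0 by simp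
  then have vV: "volume R = V" unfolding volume_def measure_def em by simp
  show "emeasure lborel (total_space R) = ennreal (volume R)" "volume R > 0" 
    "(\<lambda>n. height R (Suc n) * width R (Suc n)) \<longlonglongrightarrow> volume R"
    using em V1 lim unfolding vV by auto
  show "\<forall>n\<ge>1. height R n * width R n \<le> volume R" using le unfolding vV by simp
qed

lemma prob_space_rank_one_measure:
  assumes R: "R \<in> rank_one"
  shows "prob_space (rank_one_measure R)" unfolding rank_one_measure_def
proof (rule prob_space_uniform_measure)
  have "emeasure (restrict_space lborel (total_space R)) (total_space R) = ennreal (volume R)"
    using volume_total_space(1,2)[OF R] by (simp add: emeasure_restrict_space)
  then show "emeasure (restrict_space lborel (total_space R)) (total_space R) \<noteq> 0"
    "emeasure (restrict_space lborel (total_space R)) (total_space R) \<noteq> \<infinity>"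
    using volume_total_space(3)[OF R] by auto
qed

lemma space_rank_one_measure: "space (rank_one_measure R) = total_space R"
  unfolding rank_one_measure_def by (simp add: space_restrict_space)

lemma measure_rank_one_measure:
  assumes R: "R \<in> rank_one" and A: "A \<in> sets lborel" "A \<subseteq> total_space R"
  shows "A \<in> sets (rank_one_measure R)"
    and "measure (rank_one_measure R) A = measure lborel A / volume R"
proof -
  let ?M = "restrict_space lborel (total_space R)"
  have S: "total_space R \<in> sets lborel" by (rule volume_total_space(1)[OF R])
  have rs: "emeasure ?M B = emeasure lborel B" if "B \<subseteq> total_space R" for B
    using S that by (intro emeasure_restrict_space) simp_all
  have "A = total_space R \<inter> A" using A(2) by (simp only: Int_absorb1)
  then have As: "A \<in> sets ?M" unfolding sets_restrict_space using A(1) by (rule image_eqI)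
  then show "A \<in> sets (rank_one_measure R)" unfolding rank_one_measure_def by (simp only: sets_uniform_measure)
  have "measure (rank_one_measure R) A = measure ?M (total_space R \<inter> A) / measure ?M (total_space R)"
    unfolding rank_one_measure_def
    using volume_total_space(2,3)[OF R] As by (intro measure_uniform_measure) (simp_all add: rs)
  then show "measure (rank_one_measure R) A = measure lborel A / volume R"
    using A(2) unfolding measure_def volume_def by (simp only: rs Int_absorb1 order.refl)
qed

lemma measure_levels:
  assumes R: "R \<in> rank_one" and n: "1 \<le> n" and I: "I \<subseteq> {..<height R n}"
  shows "(\<Union>j\<in>I. level R n j) \<in> sets (rank_one_measure R)"
    and "measure (rank_one_measure R) (\<Union>j\<in>I. level R n j) = card I * width R n / volume R"
proof -
  have sub: "(\<Union>j\<in>I. level R n j) \<subseteq> total_space R" using level_subset_total[OF n] I by blast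
  show "(\<Union>j\<in>I. level R n j) \<in> sets (rank_one_measure R)"
    by (rule measure_rank_one_measure(1)[OF R emeasure_levels(1)[OF R n I] sub])
  show "measure (rank_one_measure R) (\<Union>j\<in>I. level R n j) = card I * width R n / volume R"
    using measure_rank_one_measure(2)[OF R emeasure_levels(1)[OF R n I] sub] emeasure_levels(2)[OF R n I] width_pos[OF R, of n]
    by (simp add: measure_def)
qed

definition outside :: "rank_one_system \<Rightarrow> nat \<Rightarrow> nat \<Rightarrow> nat set" where
  "outside R K n = {..<height R K} - inside R K n"

text \<open>
All levels of tower \<open>K\<close> have the same measure, so their proportion outside tower \<open>n\<close> is at most
the relative measure of the complement of tower \<open>n\<close>.
\<close>

lemma card_outside:
  fixes \<theta> :: real
  assumes R: "R \<in> rank_one" and n: "1 \<le> n" "n \<le> K" and \<theta>: "height R n * width R n \<ge> (1 - \<theta>) * volume R"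
    "\<theta> \<le> 1"
  shows "card (outside R K n) \<le> \<theta> * height R K"
proof -
  define I where "I = inside R K n"
  have I: "I \<subseteq> {..<height R K}" unfolding I_def by (rule inside_subset)
  have K: "K \<ge> 1" using n by simp
  have w: "width R K > 0" using width_pos[OF R] .
  have "ennreal (card I * width R K) = emeasure lborel (tower R n)"
    using emeasure_levels(2)[OF R K I] tower_blocks[OF R n] unfolding I_def by simp
  also have "\<dots> = ennreal (height R n * width R n)"
    using emeasure_levels(2)[OF R n(1), of "{..<height R n}"] unfolding tower_def by simp
  finally have eq: "card I * width R K = height R n * width R n"
    using w width_pos[OF R, of n] by simp
  have "(1 - \<theta>) * (height R K * width R K) \<le> (1 - \<theta>) * volume R"
    using volume_total_space(5)[OF R] K \<theta> by (intro mult_left_mono) auto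
  also have "\<dots> \<le> card I * width R K" using \<theta> eq by simp
  finally have "(1 - \<theta>) * height R K \<le> card I" using w by (simp add: mult.assoc[symmetric])
  moreover have "card (outside R K n) = height R K - card I" "card I \<le> height R K"
    unfolding outside_def I_def[symmetric] using I card_Diff_subset[of I "{..<height R K}"] finite_subset[OF I] card_mono[OF _ I]
    by auto
  ultimately show ?thesis by (simp add: algebra_simps)
qed

lemma in_level_unless_outside:
  assumes R: "R \<in> rank_one" and n: "1 \<le> n" "n \<le> K" and z: "z \<in> level R K l" "l < height R K" "l \<notin> outside R K n"
  obtains j where "j < height R n" "z \<in> level R n j"
proof -
  obtain b j where "block_start R K n b" "j < height R n" "l = b + j"
    using z(2,3) unfolding outside_def inside_def by auto
  then show thesis using that level_blocks[OF R n, of j] z(1) by blast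
qed

section \<open>Windows, partitions and words\<close>

text \<open>
Markov's inequality for counting measure: every element of \<open>Z\<close> lies in at most \<open>N\<close> windows of length
\<open>N\<close>.
\<close>

lemma card_bad_windows:
  fixes Z :: "nat set"
  assumes "finite Z"
  shows "finite {i. card {s. s < N \<and> i + s \<in> Z} * 8 > N} \<and>
    card {i. card {s. s < N \<and> i + s \<in> Z} * 8 > N} \<le> 8 * card Z"
proof (cases "N = 0")
  case False
  define B where "B = {i. card {s. s < N \<and> i + s \<in> Z} * 8 > N}"
  have "B \<subseteq> (\<Union>s<N. {i. i + s \<in> Z})"
  proof (rule subsetI, rule ccontr)
    fix i assume i: "i \<in> B" "i \<notin> (\<Union>s<N. {i. i + s \<in> Z})"
    then have "{s. s < N \<and> i + s \<in> Z} = {}" by blast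
    then have "card {s. s < N \<and> i + s \<in> Z} = 0" by (simp only: card.empty)
    then show False using i(1) unfolding B_def mem_Collect_eq by linarith
  qed
  moreover have pre: "finite {i. i + s \<in> Z} \<and> card {i. i + s \<in> Z} \<le> card Z" for s
    using finite_vimageI[OF assms, of "\<lambda>i. i + s"] card_vimage_inj_on_le[of "\<lambda>i. i + s" UNIV Z] assms
    by (auto simp: vimage_def)
  ultimately have fB: "finite B" by (meson finite_UN_I finite_lessThan finite_subset)
  have "card B * N \<le> (\<Sum>i\<in>B. card {s. s < N \<and> i + s \<in> Z} * 8)"
    using sum_bounded_below[of B N "\<lambda>i. card {s. s < N \<and> i + s \<in> Z} * 8"] unfolding B_def by force
  also have "\<dots> = 8 * (\<Sum>i\<in>B. \<Sum>s<N. if i + s \<in> Z then 1 else 0)"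
  proof -
    have "card {s. s < N \<and> i + s \<in> Z} = (\<Sum>s<N. if i + s \<in> Z then 1 else 0)" for i
      by (subst sum.If_cases) (auto simp: Int_def)
    then show ?thesis by (simp add: sum_distrib_left mult.commute)
  qed
  also have "(\<Sum>i\<in>B. \<Sum>s<N. if i + s \<in> Z then 1 else 0) = (\<Sum>s<N. card {i\<in>B. i + s \<in> Z})"
  proof (subst sum.swap, rule sum.cong)
    fix s show "(\<Sum>i\<in>B. if i + s \<in> Z then 1 else 0) = card {i \<in> B. i + s \<in> Z}"
      using fB by (subst sum.If_cases) (auto simp: Int_def)
  qed simp
  also have "\<dots> \<le> (\<Sum>s<N. card Z)"
  proof (rule sum_mono)
    fix s show "card {i \<in> B. i + s \<in> Z} \<le> card Z"
    proof -
      have "{i \<in> B. i + s \<in> Z} \<subseteq> {i. i + s \<in> Z}" by blast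
      then show ?thesis using pre[of s] card_mono le_trans by blast
    qed
  qed
  finally have "card B * N \<le> (8 * card Z) * N" by (simp add: algebra_simps)
  then have "card B \<le> 8 * card Z" using False by simp
  then show ?thesis using fB unfolding B_def by blast
qed simp

text \<open>
Names are words over the indices \<open>1, ..., q\<close>; this enumerates a finite disjoint family and puts the rest
of the space into one further cell.
\<close>

lemma partition_of_family:
  assumes "finite I" "disjoint_family_on C I" "\<And>i. i \<in> I \<Longrightarrow> C i \<in> sets M"
  obtains q P where "finite_measurable_partition M q P"
    "\<And>k. k \<in> {1..q} \<Longrightarrow> (\<exists>i\<in>I. P k = C i) \<or> P k = space M - (\<Union>i\<in>I. C i)"
proof -
  obtain e where e: "bij_betw e {1..card I} I" using ex_bij_betw_nat_finite_1[OF assms(1)] by blast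
  define P where "P k = (if k \<le> card I then C (e k) else space M - (\<Union>i\<in>I. C i))" for k
  have eI: "e k \<in> I" if "1 \<le> k" "k \<le> card I" for k using e that by (auto simp: bij_betw_def)
  have inj: "e k \<noteq> e l" if "1 \<le> k" "k \<le> card I" "1 \<le> l" "l \<le> card I" "k \<noteq> l" for k l
    using bij_betw_imp_inj_on[OF e] that by (simp add: inj_on_eq_iff)
  have rest: "space M - (\<Union>i\<in>I. C i) \<in> sets M" using assms(1,3) by (intro sets.compl_sets sets.finite_UN)
  have "disjoint_family_on P {1..card I + 1}"
    unfolding disjoint_family_on_def
  proof (intro ballI impI)
    fix k l assume kl: "k \<in> {1..card I + 1}" "l \<in> {1..card I + 1}" "k \<noteq> l"
    have sub: "P u \<subseteq> (\<Union>i\<in>I. C i)" if "1 \<le> u" "u \<le> card I" for u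
      using eI[OF that] that unfolding P_def by auto
    consider "k \<le> card I" "l \<le> card I" | "k \<le> card I" "l = card I + 1" | "k = card I + 1" "l \<le> card I"
      using kl by force
    then show "P k \<inter> P l = {}"
    proof cases
      case 1
      then have "C (e k) \<inter> C (e l) = {}"
        using kl assms(2) eI[of k] eI[of l] inj[of k l] unfolding disjoint_family_on_def by simp
      then show ?thesis using 1 by (simp add: P_def)
    next
      case 2
      then show ?thesis using sub[of k] kl by (auto simp: P_def)
    next
      case 3
      then show ?thesis using sub[of l] kl by (auto simp: P_def)
    qed
  qed
  moreover have "(\<Union>k\<in>{1..card I + 1}. P k) = space M"
  proof (intro equalityI subsetI)
    fix z assume "z \<in> (\<Union>k\<in>{1..card I + 1}. P k)"
    then obtain k where "1 \<le> k" "z \<in> P k" by auto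
    then show "z \<in> space M"
      using sets.sets_into_space[OF assms(3)[OF eI[of k]]] unfolding P_def by (auto split: if_splits)
  next
    fix z assume z: "z \<in> space M"
    show "z \<in> (\<Union>k\<in>{1..card I + 1}. P k)"
    proof (cases "z \<in> (\<Union>i\<in>I. C i)")
      case True
      then obtain i where "i \<in> I" "z \<in> C i" by auto
      moreover have "i \<in> e ` {1..card I}" using bij_betw_imp_surj_on[OF e] \<open>i \<in> I\<close> by simp
      then obtain k where "k \<in> {1..card I}" "e k = i" by blast
      ultimately have "k \<in> {1..card I + 1}" "z \<in> P k" by (auto simp: P_def)
      then show ?thesis by blast
    next
      case False
      then have "z \<in> P (card I + 1)" using z by (simp add: P_def)
      then show ?thesis by (intro UN_I[of "card I + 1"]) auto
    qed
  qed
  ultimately have "finite_measurable_partition M (card I + 1) P"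
    using rest assms(3) eI unfolding finite_measurable_partition_def by (auto simp: P_def)
  moreover have "(\<exists>i\<in>I. P k = C i) \<or> P k = space M - (\<Union>i\<in>I. C i)" if "k \<in> {1..card I + 1}" for k
    using eI[of k] that unfolding P_def by auto
  ultimately show thesis using that by blast
qed

lemma matched_letters:
  assumes P: "finite_measurable_partition M q P" and m: "matching (name_word R q P N x) (name_word R q P N y) r i j"
    and s: "s < r" and sp: "(R ^^ i s) x \<in> space M" "(R ^^ j s) y \<in> space M"
  obtains k where "k \<in> {1..q}" "(R ^^ i s) x \<in> P k" "(R ^^ j s) y \<in> P k" "i s < N" "j s < N"
proof -
  have letter: "(THE k. k \<in> {1..q} \<and> z \<in> P k) \<in> {1..q} \<and> z \<in> P (THE k. k \<in> {1..q} \<and> z \<in> P k)" 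
    if z: "z \<in> space M" for z
  proof (rule theI')
    obtain k where k: "k \<in> {1..q}" "z \<in> P k"
      using P z unfolding finite_measurable_partition_def by blast
    moreover have "l = k" if "l \<in> {1..q}" "z \<in> P l" for l
      using P k that unfolding finite_measurable_partition_def disjoint_family_on_def by blast
    ultimately show "\<exists>!k. k \<in> {1..q} \<and> z \<in> P k" by blast
  qed
  have "i s < N" "j s < N" and eq: "name_word R q P N x ! i s = name_word R q P N y ! j s"
    using m s unfolding matching_def name_word_def by auto
  then have "(THE k. k \<in> {1..q} \<and> (R ^^ i s) x \<in> P k) = (THE k. k \<in> {1..q} \<and> (R ^^ j s) y \<in> P k)"
    unfolding name_word_def by simp
  then show thesis using that letter[OF sp(1)] letter[OF sp(2)] \<open>i s < N\<close> \<open>j s < N\<close> by metis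
qed

lemma fbar_ge:
  fixes c :: real
  assumes "length A > 0" "\<And>r i j. matching A B r i j \<Longrightarrow> real r \<le> c * length A"
  shows "fbar A B \<ge> 1 - c"
proof -
  let ?S = "{r. \<exists>i j. matching A B r i j}"
  have "0 \<in> ?S" by (auto simp: matching_def strict_mono_on_def)
  moreover have "r \<le> nat \<lceil>c * length A\<rceil>" if r: "r \<in> ?S" for r
  proof -
    obtain i j where "matching A B r i j" using r by blast
    from assms(2)[OF this] show ?thesis by linarith
  qed
  then have "finite ?S" by (meson finite_nat_set_iff_bounded_le)
  ultimately have "Max ?S \<in> ?S" by (intro Max_in) auto
  then have "real (Max ?S) \<le> c * length A" using assms(2) by blast
  then show ?thesis unfolding fbar_def using assms(1) by (simp add: field_simps)
qed

section \<open>Large stages\<close>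

lemma height_at_top:
  assumes "\<forall>n\<ge>1. 1 < cuts R n"
  shows "filterlim (\<lambda>n. real (height R n)) at_top sequentially"
proof (rule filterlim_at_top_mono[OF filterlim_real_sequentially])
  show "\<forall>\<^sub>F n in sequentially. real n \<le> real (height R n)"
    using eventually_ge_at_top[of 1] by eventually_elim (simp add: height_ge[OF assms])
qed

text \<open>
Everything that the argument asks of the stages at which it starts.
\<close>

lemma eventually_good_stage:
  fixes \<gamma> \<gamma>' \<beta> :: real
  assumes R: "R \<in> class_C \<gamma> \<gamma>'" and "\<gamma>' < 1" "\<beta> > 0" "\<theta> > 0" "\<tau> > 0"
  shows "\<forall>\<^sub>F n in sequentially. n \<ge> 1 \<and> staircase \<gamma> \<gamma>' R n \<and> 2 \<le> real (height R n) powr (1 - \<gamma>')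
     \<and> tail \<beta> R n \<le> \<tau> \<and> (1 - \<theta>) * volume R \<le> height R n * width R n"
proof -
  have R1: "R \<in> rank_one" using R unfolding class_C_def by auto
  note top = height_at_top[OF rank_oneD(1)[OF R1]]
  have a: "\<forall>\<^sub>F n in sequentially. staircase \<gamma> \<gamma>' R n"
    using R unfolding class_C_def staircase_def eventually_sequentially by auto
  have b: "\<forall>\<^sub>F n in sequentially. 2 powr (1 / (1 - \<gamma>')) \<le> real (height R n)"
    using top unfolding filterlim_at_top by blast
  have "(\<lambda>n. real (height R n) powr (-\<beta>)) \<longlonglongrightarrow> 0"
    using top assms by (intro tendsto_neg_powr) auto
  then have "(\<lambda>n. tail \<beta> R n) \<longlonglongrightarrow> 0 / (1 - 2 powr (-\<beta>))"
    unfolding tail_def using powr_less_mono[of "-\<beta>" 0 2] assms by (intro tendsto_divide tendsto_const) auto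
  then have "(\<lambda>n. tail \<beta> R n) \<longlonglongrightarrow> 0" by simp
  then have c: "\<forall>\<^sub>F n in sequentially. tail \<beta> R n < \<tau>" using assms(5) by (rule order_tendstoD(2))
  have "(1 - \<theta>) * volume R < volume R" using volume_total_space(3)[OF R1] assms by simp
  with volume_total_space(4)[OF R1] have "\<forall>\<^sub>F n in sequentially. (1 - \<theta>) * volume R < height R (Suc n) * width R (Suc n)"
    by (rule order_tendstoD(1))
  then have d: "\<forall>\<^sub>F n in sequentially. (1 - \<theta>) * volume R < height R n * width R n"
    by (rule eventually_sequentially_Suc[THEN iffD1])
  from a b c d eventually_ge_at_top[of 1] show ?thesis
  proof eventually_elim
    case (elim n)
    have "2 = (2 powr (1 / (1 - \<gamma>'))) powr (1 - \<gamma>')" using assms(2) by (simp add: powr_powr)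
    also have "\<dots> \<le> real (height R n) powr (1 - \<gamma>')" using elim assms(2) by (intro powr_mono2) auto
    finally show ?case using elim by simp
  qed
qed

text \<open>
Alternation compares a height of \<open>T\<close> only with its two neighbours among the heights of \<open>S\<close>;
monotonicity of the heights extends the gap to all of them.
\<close>

lemma alternating_gap:
  assumes alt: "alternating_wrt (height T) (height S) \<delta>" and \<beta>: "0 \<le> \<beta>" "\<beta> \<le> \<delta>"
    and cuts: "\<forall>n\<ge>1. 1 < cuts T n" "\<forall>m\<ge>1. 1 < cuts S m"
  obtains n\<^sub>1 where "n\<^sub>1 \<ge> 1"
    "\<And>n m. n \<ge> n\<^sub>1 \<Longrightarrow> m \<ge> 1 \<Longrightarrow> height T n < height S m \<Longrightarrow>
        real (height T n) powr (1 + \<beta>) \<le> real (height S m)"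
    "\<And>n m. n \<ge> n\<^sub>1 \<Longrightarrow> m \<ge> 1 \<Longrightarrow> height S m \<le> height T n \<Longrightarrow>
        real (height S m) powr (1 + \<beta>) \<le> real (height T n)"
proof -
  obtain n\<^sub>1 where n1: "n\<^sub>1 \<ge> 1" and gap: "\<And>n m. n \<ge> n\<^sub>1 \<Longrightarrow> m \<ge> 1 \<Longrightarrow> height S m \<le> height T n \<Longrightarrow>
      height T n < height S (m + 1) \<Longrightarrow> real (height S m) powr (1 + \<delta>) < real (height T n) \<and>
      real (height T n) powr (1 + \<delta>) < real (height S (m + 1))"
    using alt unfolding alternating_wrt_def by blast
  have pow: "real h powr (1 + \<beta>) \<le> real h powr (1 + \<delta>)" if "h \<ge> 1" for h :: nat
    using that \<beta> by (intro powr_mono) auto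
  have index: "\<exists>u\<ge>1. height S u \<le> height T n \<and> height T n < height S (u + 1)" if n: "n \<ge> n\<^sub>1" for n
  proof -
    define u where "u = (LEAST u. u \<ge> 1 \<and> height T n < height S (u + 1))"
    have "height T n + 1 \<ge> 1 \<and> height T n < height S (height T n + 1 + 1)"
      using height_ge[OF cuts(2), of "height T n + 1 + 1"] by simp
    then have u: "u \<ge> 1 \<and> height T n < height S (u + 1)" unfolding u_def by (rule LeastI)
    have "height S u \<le> height T n"
    proof (cases "u = 1")
      case True
      then show ?thesis using height_pos[OF cuts(1), of n] n n1 by simp
    next
      case False
      then have "\<not> (u - 1 \<ge> 1 \<and> height T n < height S (u - 1 + 1))"
        using u not_less_Least[of "u - 1" "\<lambda>u. u \<ge> 1 \<and> height T n < height S (u + 1)"] unfolding u_def by simp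
      then show ?thesis using False u by (simp; linarith)
    qed
    then show ?thesis using u by blast
  qed
  show thesis
  proof (rule that[OF n1])
    fix n m assume nm: "n \<ge> n\<^sub>1" "m \<ge> 1" "height T n < height S m"
    obtain u where u: "u \<ge> 1" "height S u \<le> height T n" "height T n < height S (u + 1)" using index nm by blast
    have "u + 1 \<le> m"
    proof (rule ccontr)
      assume "\<not> ?thesis"
      then have "height S m \<le> height S u" using height_mono[OF cuts(2), of m u] nm by simp
      then show False using u nm by simp
    qed
    then have "height S (u + 1) \<le> height S m" using height_mono[OF cuts(2), of "u + 1" m] u by simp
    moreover have "real (height T n) powr (1 + \<beta>) \<le> real (height T n) powr (1 + \<delta>)"
      using height_pos[OF cuts(1), of n] nm n1 by (intro pow) auto
    ultimately show "real (height T n) powr (1 + \<beta>) \<le> real (height S m)"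
      using gap[OF nm(1) u] by linarith
  next
    fix n m assume nm: "n \<ge> n\<^sub>1" "m \<ge> 1" "height S m \<le> height T n"
    obtain u where u: "u \<ge> 1" "height S u \<le> height T n" "height T n < height S (u + 1)" using index nm by blast
    have "m \<le> u"
    proof (rule ccontr)
      assume "\<not> ?thesis"
      then have "height S (u + 1) \<le> height S m" using height_mono[OF cuts(2), of "u + 1" m] u by simp
      then show False using u nm by simp
    qed
    then have "height S m \<le> height S u" using height_mono[OF cuts(2), of m u] nm by simp
    then have "real (height S m) powr (1 + \<beta>) \<le> real (height S u) powr (1 + \<beta>)"
      using \<beta> by (intro powr_mono2) auto
    moreover have "real (height S u) powr (1 + \<beta>) \<le> real (height S u) powr (1 + \<delta>)"
      using height_pos[OF cuts(2), of u] u by (intro pow) auto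
    ultimately show "real (height S m) powr (1 + \<beta>) \<le> real (height T n)"
      using gap[OF nm(1) u] by linarith
  qed
qed

section \<open>Matchings of typical names are short\<close>

lemma map_prod_funpow:
  fixes f :: "'a \<Rightarrow> 'a" and g :: "'b \<Rightarrow> 'b"
  shows "(map_prod f g ^^ n) (x, y) = ((f ^^ n) x, (g ^^ n) y)"
  by (induction n) auto

text \<open>
Two matched letters are equal either because both orbits are on the same levels of the towers
\<open>n\<^sub>0\<close> and \<open>m\<^sub>0\<close>, and \<open>few_synced_pairs\<close> bounds the number of such pairs by \<open>N / 4\<close>, or because the
first orbit is outside one of these towers, which happens at most \<open>N / 8\<close> times for each of the two.
\<close>

lemma matching_bound:
  fixes T S :: rank_one_system and \<beta> \<gamma> \<gamma>' :: real
  assumes R: "T \<in> rank_one" "S \<in> rank_one"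
    and \<beta>: "0 < \<beta>" "\<beta> \<le> \<gamma>" "\<beta> \<le> 1 - \<gamma>'"
    and start: "1 \<le> n\<^sub>0" "1 \<le> m\<^sub>0" "n\<^sub>0 \<le> K" "m\<^sub>0 \<le> L"
    and stair: "\<And>n. n \<ge> n\<^sub>0 \<Longrightarrow> staircase \<gamma> \<gamma>' T n" "\<And>m. m \<ge> m\<^sub>0 \<Longrightarrow> staircase \<gamma> \<gamma>' S m"
    and large: "\<And>n. n \<ge> n\<^sub>0 \<Longrightarrow> 2 \<le> real (height T n) powr (1 - \<gamma>')" 
      "\<And>m. m \<ge> m\<^sub>0 \<Longrightarrow> 2 \<le> real (height S m) powr (1 - \<gamma>')"
    and gap: "\<And>n m. n \<ge> n\<^sub>0 \<Longrightarrow> m \<ge> m\<^sub>0 \<Longrightarrow> height T n < height S m \<Longrightarrow>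
        real (height T n) powr (1 + \<beta>) \<le> real (height S m)"
      "\<And>n m. n \<ge> n\<^sub>0 \<Longrightarrow> m \<ge> m\<^sub>0 \<Longrightarrow> height S m \<le> height T n \<Longrightarrow>
        real (height S m) powr (1 + \<beta>) \<le> real (height T n)"
    and tails: "tail \<beta> T n\<^sub>0 \<le> 1 / 1200" "tail \<beta> S m\<^sub>0 \<le> 1 / 1200"
    and KL: "height T K < height S L" and N: "height T K \<le> 16 * N"
    and P: "finite_measurable_partition (rank_one_measure T \<Otimes>\<^sub>M rank_one_measure S) q P"
      "\<And>k. k \<in> {1..q} \<Longrightarrow> (\<exists>(a, b)\<in>{..<height T n\<^sub>0} \<times> {..<height S m\<^sub>0}. P k = level T n\<^sub>0 a \<times> level S m\<^sub>0 b) \<or>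
         P k \<inter> (\<Union>(a, b)\<in>{..<height T n\<^sub>0} \<times> {..<height S m\<^sub>0}. level T n\<^sub>0 a \<times> level S m\<^sub>0 b) = {}"
    and pt: "x \<in> level T K i" "y \<in> level S L j" "x' \<in> level T K i'" "y' \<in> level S L j'"
    and fit: "i + N \<le> i'" "i' + N \<le> height T K" "j + N \<le> height S L" "j' + N \<le> height S L"
    and typical: "card {s. s < N \<and> i + s \<in> outside T K n\<^sub>0} * 8 \<le> N"
      "card {s. s < N \<and> j + s \<in> outside S L m\<^sub>0} * 8 \<le> N"
    and m: "matching (name_word (map_prod (transf T) (transf S)) q P N (x, y))
       (name_word (map_prod (transf T) (transf S)) q P N (x', y')) r f g"
  shows "real r \<le> N / 2"
proof -
  let ?F = "map_prod (transf T) (transf S)" and ?M = "rank_one_measure T \<Otimes>\<^sub>M rank_one_measure S"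
  have KL1: "K \<ge> 1" "L \<ge> 1" using start by auto
  have orb: "(transf T ^^ s) x \<in> level T K (i + s)" "(transf T ^^ s) x' \<in> level T K (i' + s)"
    "(transf S ^^ s) y \<in> level S L (j + s)" "(transf S ^^ s) y' \<in> level S L (j' + s)"
    "i + s < height T K" "i' + s < height T K" "j + s < height S L" "j' + s < height S L" if "s < N" for s
    using that fit orbit_in_level[OF R(1) KL1(1) pt(1)] orbit_in_level[OF R(1) KL1(1) pt(3)]
      orbit_in_level[OF R(2) KL1(2) pt(2)] orbit_in_level[OF R(2) KL1(2) pt(4)] by auto
  have sp: "(?F ^^ s) (x, y) \<in> space ?M" "(?F ^^ s) (x', y') \<in> space ?M" if "s < N" for s
    using orb[OF that] level_subset_total[OF KL1(1), of _ T] level_subset_total[OF KL1(2), of _ S]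
    unfolding map_prod_funpow space_pair_measure space_rank_one_measure by auto
  define M where "M = (\<lambda>s. (f s, g s)) ` {..<r}"
  have lt: "f s < N" "g s < N" if "s < r" for s
    using m that unfolding matching_def name_word_def by auto
  have mono: "strict_mono_on {..<r} f" "strict_mono_on {..<r} g"
    using m unfolding matching_def by auto
  have less_iff: "f s < f s' \<longleftrightarrow> s < s'" "g s < g s' \<longleftrightarrow> s < s'" if "s < r" "s' < r" for s s'
    using mono that by (auto simp: strict_mono_on_less)
  have inj: "inj_on f {..<r}" using mono(1) by (rule strict_mono_on_imp_inj_on)
  have cardM: "card M = r" unfolding M_def using inj by (subst card_image) (auto simp: inj_on_def)
  have M: "M \<subseteq> {..<N} \<times> {..<N}" unfolding M_def using lt by auto
  have finM: "finite M" unfolding M_def by simp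
  have chain: "fst p < fst p' \<longleftrightarrow> snd p < snd p'" if "p \<in> M" "p' \<in> M" for p p'
    using that less_iff unfolding M_def by auto
  have injM: "inj_on fst M" using inj unfolding M_def inj_on_def by auto
  define G where "G = {(s, t) \<in> M. synced T K n\<^sub>0 (i + s) (i' + t) \<and> synced S L m\<^sub>0 (j + s) (j' + t)}"
  define OT where "OT = {s. s < N \<and> i + s \<in> outside T K n\<^sub>0}"
  define OS where "OS = {s. s < N \<and> j + s \<in> outside S L m\<^sub>0}"
  have fin: "finite OT" "finite OS" unfolding OT_def OS_def by auto
  have "fst ` (M - G) \<subseteq> OT \<union> OS"
  proof
    fix s assume "s \<in> fst ` (M - G)"
    then obtain u where u: "u < r" "s = f u" "(f u, g u) \<notin> G" unfolding M_def by auto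
    define t where "t = g u"
    have st: "s < N" "t < N" using lt u t_def by auto
    obtain k where k: "k \<in> {1..q}" "(?F ^^ s) (x, y) \<in> P k" "(?F ^^ t) (x', y') \<in> P k"
      using matched_letters[OF P(1) m u(1)] sp st u t_def by auto
    show "s \<in> OT \<union> OS"
    proof (rule ccontr)
      assume no: "s \<notin> OT \<union> OS"
      obtain a where a: "a < height T n\<^sub>0" "(transf T ^^ s) x \<in> level T n\<^sub>0 a"
        using in_level_unless_outside[OF R(1) start(1,3) orb(1)[OF st(1)] orb(5)[OF st(1)]] no st
        unfolding OT_def by auto
      obtain b where b: "b < height S m\<^sub>0" "(transf S ^^ s) y \<in> level S m\<^sub>0 b"
        using in_level_unless_outside[OF R(2) start(2,4) orb(3)[OF st(1)] orb(7)[OF st(1)]] no st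
        unfolding OS_def by auto
      have "P k \<inter> (\<Union>(a, b)\<in>{..<height T n\<^sub>0} \<times> {..<height S m\<^sub>0}. level T n\<^sub>0 a \<times> level S m\<^sub>0 b) \<noteq> {}"
        using k(2) a b unfolding map_prod_funpow by auto
      then obtain c d where cd: "c < height T n\<^sub>0" "d < height S m\<^sub>0" "P k = level T n\<^sub>0 c \<times> level S m\<^sub>0 d"
        using P(2)[OF k(1)] by auto
      have in_cd: "(transf T ^^ s) x \<in> level T n\<^sub>0 c" "(transf T ^^ t) x' \<in> level T n\<^sub>0 c"
        "(transf S ^^ s) y \<in> level S m\<^sub>0 d" "(transf S ^^ t) y' \<in> level S m\<^sub>0 d"
        using k(2,3) unfolding cd(3) map_prod_funpow by auto
      obtain b1 where b1: "block_start T K n\<^sub>0 b1" "i + s = b1 + c"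
        using level_position[OF R(1) start(1,3) cd(1) in_cd(1) orb(5)[OF st(1)] orb(1)[OF st(1)]] .
      obtain b2 where b2: "block_start T K n\<^sub>0 b2" "i' + t = b2 + c"
        using level_position[OF R(1) start(1,3) cd(1) in_cd(2) orb(6)[OF st(2)] orb(2)[OF st(2)]] .
      obtain b3 where b3: "block_start S L m\<^sub>0 b3" "j + s = b3 + d"
        using level_position[OF R(2) start(2,4) cd(2) in_cd(3) orb(7)[OF st(1)] orb(3)[OF st(1)]] .
      obtain b4 where b4: "block_start S L m\<^sub>0 b4" "j' + t = b4 + d"
        using level_position[OF R(2) start(2,4) cd(2) in_cd(4) orb(8)[OF st(2)] orb(4)[OF st(2)]] .
      have "synced T K n\<^sub>0 (i + s) (i' + t)" unfolding synced_def using b1 b2 cd(1) by blast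
      moreover have "synced S L m\<^sub>0 (j + s) (j' + t)" unfolding synced_def using b3 b4 cd(2) by blast
      moreover have "(s, t) \<in> M" using u unfolding M_def t_def by auto
      ultimately have "(s, t) \<in> G" unfolding G_def by blast
      then show False using u unfolding t_def by simp
    qed
  qed
  then have "card (fst ` (M - G)) \<le> card OT + card OS"
    using card_mono[of "OT \<union> OS"] card_Un_le[of OT OS] fin le_trans by blast
  moreover have "card (fst ` (M - G)) = card (M - G)"
    using injM by (intro card_image) (auto intro: inj_on_subset)
  moreover have "card M \<le> card G + card (M - G)"
  proof -
    have "M = G \<union> (M - G)" unfolding G_def by blast
    then show ?thesis using card_Un_le[of G "M - G"] by simp
  qed
  ultimately have "r \<le> card G + card OT + card OS" using cardM by simp
  moreover have "real (card G) \<le> 150 * real N * (tail \<beta> T n\<^sub>0 + tail \<beta> S m\<^sub>0)"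
    unfolding G_def
    by (rule few_synced_pairs[OF \<beta> rank_oneD(1)[OF R(1)] rank_oneD(1)[OF R(2)] start(1,2) stair large gap KL N fit(1) M chain])
      (use start in auto)
  moreover have "150 * real N * (tail \<beta> T n\<^sub>0 + tail \<beta> S m\<^sub>0) \<le> 150 * real N * (1 / 1200 + 1 / 1200)"
    using tails by (intro mult_left_mono) auto
  moreover have "card OT * 8 \<le> N" "card OS * 8 \<le> N" using typical unfolding OT_def OS_def by auto
  ultimately show ?thesis by simp
qed

text \<open>
By \<open>card_bad_windows\<close> few starting levels see tower \<open>n\<close> too rarely, so an eighth of the height survives
from any initial segment of at least a quarter.
\<close>

lemma card_typical_starts:
  fixes N :: nat
  assumes R: "R \<in> rank_one" and n: "1 \<le> n" "n \<le> K"
    and \<theta>: "(1 - 1 / 256) * volume R \<le> height R n * width R n"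
    and h: "height R K \<ge> 64" and c: "c \<ge> height R K div 4" "c \<le> height R K"
  defines "I \<equiv> {i. i < c \<and> card {s. s < N \<and> i + s \<in> outside R K n} * 8 \<le> N}"
  shows "card I \<ge> height R K / 8"
proof -
  let ?B = "{i. card {s. s < N \<and> i + s \<in> outside R K n} * 8 > N}"
  have o: "card (outside R K n) \<le> 1 / 256 * height R K" by (rule card_outside[OF R n \<theta>]) simp
  have fo: "finite (outside R K n)" unfolding outside_def by simp
  have "{..<c} \<subseteq> I \<union> (?B \<inter> {..<c})" unfolding I_def by auto
  then have "card {..<c} \<le> card (I \<union> (?B \<inter> {..<c}))" by (intro card_mono) (auto simp: I_def)
  also have "\<dots> \<le> card I + card (?B \<inter> {..<c})" by (rule card_Un_le)
  also have "card (?B \<inter> {..<c}) \<le> 8 * card (outside R K n)"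
  proof -
    note bad = card_bad_windows[OF fo, of N]
    have "card (?B \<inter> {..<c}) \<le> card ?B" using bad by (intro card_mono) auto
    then show ?thesis using bad by linarith
  qed
  finally have "real c \<le> card I + 8 * card (outside R K n)" by simp
  then show ?thesis using o c h by linarith
qed

lemma measure_level_set_ge:
  assumes R: "R \<in> rank_one" and n: "1 \<le> n" and I: "I \<subseteq> {..<height R n}"
    and \<theta>: "(1 - 1 / 256) * volume R \<le> height R n * width R n"
    and card: "card I \<ge> height R n / 8"
  shows "measure (rank_one_measure R) (\<Union>i\<in>I. level R n i) \<ge> 1 / 16"
proof -
  have v: "volume R > 0" using volume_total_space(3)[OF R] .
  have "volume R / 16 \<le> (1 - 1 / 256) * volume R / 8" using v by simp
  also have "\<dots> \<le> height R n * width R n / 8" using \<theta> by simp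
  also have "\<dots> = (height R n / 8) * width R n" by simp
  also have "\<dots> \<le> card I * width R n" using card width_pos[OF R, of n] by (intro mult_right_mono) auto
  finally have "1 / 16 \<le> card I * width R n / volume R"
    using v by (simp add: pos_le_divide_eq)
  then show ?thesis using measure_levels(2)[OF R n I] by simp
qed

lemma measure_pair_times:
  assumes "prob_space M" "prob_space M'" "A \<in> sets M" "B \<in> sets M'"
  shows "measure (M \<Otimes>\<^sub>M M') (A \<times> B) = measure M A * measure M' B"
proof -
  interpret M: prob_space M by fact
  interpret M': prob_space M' by fact
  show ?thesis unfolding measure_def
    using assms(3,4) by (simp add: M'.emeasure_pair_measure_Times enn2real_mult)
qed

lemma (in prob_space) large_sets_meet:
  assumes "A \<in> events" "B \<in> events" "prob A + prob B > 1"
  shows "A \<inter> B \<noteq> {}"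
proof
  assume "A \<inter> B = {}"
  then have "prob (A \<union> B) = prob A + prob B" using assms by (intro finite_measure_Union) auto
  then show False using assms(3) prob_le_1[of "A \<union> B"] by simp
qed

theorem theorem1:
  fixes \<gamma> \<gamma>' \<delta> :: real and T S :: rank_one_system
  assumes "0 < \<gamma>" and "\<gamma> < \<gamma>'" and "\<gamma>' < 1"
    and "0 < \<delta>" and "\<delta> < \<gamma>"
    and "weakly_mixing (rank_one_measure T) (transf T)"
    and "(T, S) \<in> class_L \<gamma> \<gamma>' \<delta>"
  shows "\<not> loosely_bernoulli (rank_one_measure T \<Otimes>\<^sub>M rank_one_measure S)
            (map_prod (transf T) (transf S))"
proof
  let ?M = "rank_one_measure T \<Otimes>\<^sub>M rank_one_measure S" and ?F = "map_prod (transf T) (transf S)"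
  assume LB: "loosely_bernoulli ?M ?F"
  have TC: "T \<in> class_C \<gamma> \<gamma>'" "S \<in> class_C \<gamma> \<gamma>'" and alt: "alternating_wrt (height T) (height S) \<delta>"
    using assms(7) unfolding class_L_def alternating_def by auto
  then have R: "T \<in> rank_one" "S \<in> rank_one" unfolding class_C_def by auto
  note cuts = rank_oneD(1)[OF R(1)] rank_oneD(1)[OF R(2)]
  define \<beta> where "\<beta> = min \<gamma> (min \<delta> (1 - \<gamma>'))"
  have \<beta>: "0 < \<beta>" "\<beta> \<le> \<gamma>" "\<beta> \<le> 1 - \<gamma>'" "0 \<le> \<beta>" "\<beta> \<le> \<delta>" using assms(1-5) unfolding \<beta>_def by auto
  obtain n\<^sub>1 where n1: "n\<^sub>1 \<ge> 1" and
    gap: "\<And>n m. n \<ge> n\<^sub>1 \<Longrightarrow> m \<ge> 1 \<Longrightarrow> height T n < height S m \<Longrightarrow>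
        real (height T n) powr (1 + \<beta>) \<le> real (height S m)"
      "\<And>n m. n \<ge> n\<^sub>1 \<Longrightarrow> m \<ge> 1 \<Longrightarrow> height S m \<le> height T n \<Longrightarrow>
        real (height S m) powr (1 + \<beta>) \<le> real (height T n)"
    using alternating_gap[OF alt \<beta>(4,5) cuts] by blast
  \<comment> \<open>The tails are chosen such that \<open>150 * (1 / 1200 + 1 / 1200) = 1 / 4\<close>.\<close>
  define good where "good R n \<longleftrightarrow> n \<ge> 1 \<and> staircase \<gamma> \<gamma>' R n \<and> 2 \<le> real (height R n) powr (1 - \<gamma>')
     \<and> tail \<beta> R n \<le> 1 / 1200 \<and> (1 - 1 / 256) * volume R \<le> height R n * width R n" for R n
  obtain n\<^sub>2 m\<^sub>0 where good: "\<And>n. n \<ge> n\<^sub>2 \<Longrightarrow> good T n" "\<And>m. m \<ge> m\<^sub>0 \<Longrightarrow> good S m"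
    using eventually_good_stage[OF TC(1) assms(3) \<beta>(1), of "1 / 256" "1 / 1200"]
      eventually_good_stage[OF TC(2) assms(3) \<beta>(1), of "1 / 256" "1 / 1200"]
    unfolding good_def eventually_sequentially by auto
  define n\<^sub>0 where "n\<^sub>0 = max n\<^sub>1 n\<^sub>2"
  have n0: "n\<^sub>0 \<ge> n\<^sub>1" "\<And>n. n \<ge> n\<^sub>0 \<Longrightarrow> good T n" using good(1) unfolding n\<^sub>0_def by auto
  have nm1: "1 \<le> n\<^sub>0" "1 \<le> m\<^sub>0" using n0(2)[of "n\<^sub>0"] good(2)[of m\<^sub>0] unfolding good_def by auto
  \<comment> \<open>The partition: products of levels of two fixed towers that fill almost everything, and the
    remaining set as one further cell.\<close>
  define I where "I = {..<height T n\<^sub>0} \<times> {..<height S m\<^sub>0}"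
  define C where "C = (\<lambda>(a, b). level T n\<^sub>0 a \<times> level S m\<^sub>0 b)"
  have lev: "level T n\<^sub>0 a \<in> sets (rank_one_measure T)" if "a < height T n\<^sub>0" for a
    using measure_levels(1)[OF R(1) nm1(1), of "{a}"] that by simp
  have lev': "level S m\<^sub>0 b \<in> sets (rank_one_measure S)" if "b < height S m\<^sub>0" for b
    using measure_levels(1)[OF R(2) nm1(2), of "{b}"] that by simp
  have disj: "disjoint_family_on C I"
    unfolding disjoint_family_on_def
  proof (intro ballI impI)
    fix u v assume uv: "u \<in> I" "v \<in> I" "u \<noteq> v"
    obtain a b c d where ab: "u = (a, b)" "v = (c, d)" by (cases u, cases v)
    show "C u \<inter> C v = {}"
    proof (cases "a = c")
      case True
      then have "level S m\<^sub>0 b \<inter> level S m\<^sub>0 d = {}"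
        using rank_oneD(2)[OF R(2) nm1(2)] uv ab unfolding disjoint_family_on_def I_def by auto
      then show ?thesis unfolding C_def ab by auto
    next
      case False
      then have "level T n\<^sub>0 a \<inter> level T n\<^sub>0 c = {}"
        using rank_oneD(2)[OF R(1) nm1(1)] uv ab unfolding disjoint_family_on_def I_def by auto
      then show ?thesis unfolding C_def ab by auto
    qed
  qed
  have CM: "C u \<in> sets ?M" if "u \<in> I" for u
    using that lev lev' unfolding C_def I_def by (auto intro!: pair_measureI)
  obtain q P where P: "finite_measurable_partition ?M q P"
    and cells: "\<And>k. k \<in> {1..q} \<Longrightarrow> (\<exists>u\<in>I. P k = C u) \<or> P k = space ?M - (\<Union>u\<in>I. C u)"
    using partition_of_family[OF _ disj CM] unfolding I_def by blast
  \<comment> \<open>The sets found below have measure at least \<open>1 / 16 * (1 / 16)\<close>, so that they meet \<open>A\<close>.\<close>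
  obtain N\<epsilon> A where A: "A \<in> sets ?M" "measure ?M A > 1 - 1 / 256"
    and close: "\<And>z z' N. z \<in> A \<Longrightarrow> z' \<in> A \<Longrightarrow> N \<ge> N\<epsilon> \<Longrightarrow>
       fbar (name_word ?F q P N z) (name_word ?F q P N z') < 1 / 256"
    using LB P unfolding loosely_bernoulli_def loosely_bernoulli_process_def
    by (metis zero_less_divide_1_iff zero_less_numeral)
  \<comment> \<open>Height 64 makes the rounding in quarters and eighths of tower \<open>K\<close> harmless.\<close>
  define K where "K = max n\<^sub>0 (max 64 (8 * N\<epsilon>))"
  define N where "N = height T K div 8"
  define L where "L = max m\<^sub>0 (height T K + 1)"
  have K: "n\<^sub>0 \<le> K" "1 \<le> K" "64 \<le> K" "8 * N\<epsilon> \<le> K" unfolding K_def by auto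
  then have "K \<le> height T K" using height_ge[OF cuts(1)] by blast
  with K have K: "n\<^sub>0 \<le> K" "1 \<le> K" "64 \<le> height T K" "N\<epsilon> \<le> N" unfolding N_def by linarith+
  have L: "m\<^sub>0 \<le> L" "1 \<le> L" "height T K < L" unfolding L_def by auto
  then have "L \<le> height S L" using height_ge[OF cuts(2)] by blast
  with L have L: "m\<^sub>0 \<le> L" "1 \<le> L" "height T K < height S L" by linarith+
  define IX where "IX = {i. i < height T K div 4 \<and> card {s. s < N \<and> i + s \<in> outside T K n\<^sub>0} * 8 \<le> N}"
  define IX' where "IX' = {height T K div 2..<height T K div 2 + height T K div 4}"
  define IY where "IY = {j. j < height S L div 2 \<and> card {s. s < N \<and> j + s \<in> outside S L m\<^sub>0} * 8 \<le> N}"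
  have \<theta>: "(1 - 1 / 256) * volume T \<le> height T n\<^sub>0 * width T n\<^sub>0" "(1 - 1 / 256) * volume T \<le> height T K * width T K"
    "(1 - 1 / 256) * volume S \<le> height S m\<^sub>0 * width S m\<^sub>0" "(1 - 1 / 256) * volume S \<le> height S L * width S L"
    using n0(2)[of n\<^sub>0] n0(2)[of K] good(2)[of m\<^sub>0] good(2)[of L] K L unfolding good_def by auto
  have sub: "IX \<subseteq> {..<height T K}" "IX' \<subseteq> {..<height T K}" "IY \<subseteq> {..<height S L}"
    unfolding IX_def IX'_def IY_def by auto
  have cardIX: "card IX \<ge> height T K / 8"
    unfolding IX_def using K by (intro card_typical_starts[OF R(1) nm1(1) _ \<theta>(1)]) auto
  have cardIY: "card IY \<ge> height S L / 8"
    unfolding IY_def using K L by (intro card_typical_starts[OF R(2) nm1(2) _ \<theta>(3)]) auto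
  have cardIX': "card IX' \<ge> height T K / 8" unfolding IX'_def using K by simp
  define box where "box I = (\<Union>i\<in>I. level T K i) \<times> (\<Union>j\<in>IY. level S L j)" for I
  interpret T: prob_space "rank_one_measure T" by (rule prob_space_rank_one_measure[OF R(1)])
  interpret S: prob_space "rank_one_measure S" by (rule prob_space_rank_one_measure[OF R(2)])
  interpret TS: pair_prob_space "rank_one_measure T" "rank_one_measure S" ..
  have meets: "A \<inter> box J \<noteq> {}" if J: "J \<subseteq> {..<height T K}" "card J \<ge> height T K / 8" for J
  proof (rule TS.large_sets_meet[OF A(1)])
    show "box J \<in> sets ?M" unfolding box_def
      using measure_levels(1)[OF R(1) K(2) J(1)] measure_levels(1)[OF R(2) L(2) sub(3)] by simp
    have "measure ?M (box J) = measure (rank_one_measure T) (\<Union>i\<in>J. level T K i)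
        * measure (rank_one_measure S) (\<Union>j\<in>IY. level S L j)"
      unfolding box_def by (rule measure_pair_times[OF T.prob_space_axioms S.prob_space_axioms
          measure_levels(1)[OF R(1) K(2) J(1)] measure_levels(1)[OF R(2) L(2) sub(3)]])
    moreover have "1 / 16 * (1 / 16) \<le> measure (rank_one_measure T) (\<Union>i\<in>J. level T K i)
        * measure (rank_one_measure S) (\<Union>j\<in>IY. level S L j)"
      using measure_level_set_ge[OF R(1) K(2) J(1) \<theta>(2) J(2)]
        measure_level_set_ge[OF R(2) L(2) sub(3) \<theta>(4) cardIY] by (intro mult_mono) auto
    ultimately show "measure ?M A + measure ?M (box J) > 1" using A(2) by simp
  qed
  obtain x y i j where xy: "(x, y) \<in> A" "i \<in> IX" "x \<in> level T K i" "j \<in> IY" "y \<in> level S L j"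
    using meets[OF sub(1) cardIX] unfolding box_def by blast
  obtain x' y' i' j' where xy': "(x', y') \<in> A" "i' \<in> IX'" "x' \<in> level T K i'" "j' \<in> IY" "y' \<in> level S L j'"
    using meets[OF sub(2) cardIX'] unfolding box_def by blast
  have "i < height T K div 4" "i' \<ge> height T K div 2" "i' < height T K div 2 + height T K div 4"
    "j < height S L div 2" "j' < height S L div 2"
    using xy(2,4) xy'(2,4) unfolding IX_def IX'_def IY_def by auto
  then have N1: "height T K \<le> 16 * N" "N > 0" "i + N \<le> i'" "i' + N \<le> height T K" "j + N \<le> height S L" "j' + N \<le> height S L"
    using K L unfolding N_def by linarith+
  have cells': "(\<exists>(a, b)\<in>{..<height T n\<^sub>0} \<times> {..<height S m\<^sub>0}. P k = level T n\<^sub>0 a \<times> level S m\<^sub>0 b) \<or>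
         P k \<inter> (\<Union>(a, b)\<in>{..<height T n\<^sub>0} \<times> {..<height S m\<^sub>0}. level T n\<^sub>0 a \<times> level S m\<^sub>0 b) = {}"
    if "k \<in> {1..q}" for k
    using cells[OF that] unfolding I_def C_def by (auto simp: case_prod_beta)
  have "fbar (name_word ?F q P N (x, y)) (name_word ?F q P N (x', y')) \<ge> 1 - 1 / 2"
  proof (rule fbar_ge)
    show "length (name_word ?F q P N (x, y)) > 0" unfolding name_word_def using N1 by simp
    fix r f g assume m: "matching (name_word ?F q P N (x, y)) (name_word ?F q P N (x', y')) r f g"
    have "real r \<le> N / 2"
      by (rule matching_bound[OF R \<beta>(1-3) nm1 K(1) L(1) _ _ _ _ _ _ _ _ L(3) N1(1) P cells' xy(3,5) xy'(3,5) N1(3-6) _ _ m])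
        (use n0 good(2) gap nm1 xy in \<open>auto simp: good_def IX_def IY_def\<close>)
    then show "real r \<le> 1 / 2 * length (name_word ?F q P N (x, y))" unfolding name_word_def by simp
  qed
  then show False using close[OF xy(1) xy'(1) K(4)] by simp
qed

end
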